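(* There exist constants $C>0$ and $\kappa_0>0$, depending only on $d,\mu,\Sigma$, such that for all $\kappa\in[\kappa_0,\infty)$, all $\epsilon,\delta\in(0,1)$ and all integers $$n\ \ge\ \frac{\exp(C\kappa^2)}{\epsilon^4}\Big(1+\log\frac1\epsilon+\log\frac1\delta\Big),$$ if $S=\{(x_i,y_i)\}_{i=1}^n$ is drawn i.i.d. from $\mathcal{D}_\kappa$, then with probability at least $1-\delta$ the ERM loss $\mathcal{L}_S$ has a unique minimizer $\hat w_S^*$ over $\mathbb{R}^d$ and $\mathrm{sim}(\hat w_S^*,\Sigma^{-1}\mu)\ge 1-\epsilon$.
   Context: Fix $d\ge 1$, a nonzero vector $\mu\in\mathbb{R}^d$ and a (symmetric) positive definite matrix $\Sigma\in\mathbb{R}^{d\times d}$ with $\|\mu\|^2=\|\Sigma\|$ ($\ell_2$ norm for vectors, spectral norm for matrices). For $\kappa\in(0,\infty)$, $\mathcal{D}_\kappa$ is the distribution of $(x,y)\in\mathbb{R}^d\times\{0,1\}$ with $y$ uniform on $\{0,1\}$, $x\mid y=1\sim N(\mu,\kappa^{-1}\Sigma)$ and $x\mid y=0\sim N(-\mu,\kappa^{-1}\Sigma)$. Let $l(z)=\log(1+e^{-z})$. The ERM loss of $S=\{(x_i,y_i)\}_{i=1}^n$ is $$\mathcal{L}_S(w)=\frac1n\sum_{i=1}^n\big[y_i\,l(w^\top x_i)+(1-y_i)\,l(-w^\top x_i)\big],\quad w\in\mathbb{R}^d.$$ For nonzero $u,v\in\mathbb{R}^d$, $\mathrm{sim}(u,v)=\frac{u^\top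 v}{\|u\|\|v\|}$ (the assertion about $\mathrm{sim}$ includes that $\hat w_S^*\neq 0$). *)

theory Defs
  imports "HOL-Probability.Probability"
begin

definition pos_def :: "real ^ 'n ^ 'n \<Rightarrow> bool" where
  "pos_def A \<longleftrightarrow> transpose A = A \<and> (\<forall>x. x \<noteq> 0 \<longrightarrow> x \<bullet> (A *v x) > 0)"

abbreviation spectral_norm :: "real ^ 'n ^ 'n \<Rightarrow> real" where
  "spectral_norm A \<equiv> onorm ((*v) A)"

text \<open>The normal distribution with mean m and positive definite covariance matrix A.\<close>

definition mvn_density :: "real ^ 'n \<Rightarrow> real ^ 'n ^ 'n \<Rightarrow> real ^ 'n \<Rightarrow> real" where
  "mvn_density m A x =
     exp (- ((x - m) \<bullet> (matrix_inv A *v (x - m))) / 2) / sqrt ((2 * pi) ^ CARD('n) * det A)"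

definition mvn :: "real ^ 'n \<Rightarrow> real ^ 'n ^ 'n \<Rightarrow> (real ^ 'n) measure" where
  "mvn m A = density lborel (\<lambda>x. ennreal (mvn_density m A x))"

text \<open>Labels are the natural numbers 0 and 1, and the label space carries the discrete
  sigma-algebra on all of nat. Here bind is the Giry monad's: the label is drawn first, then the
  feature vector from its conditional distribution given the label.\<close>

definition data_dist ::
  "real ^ 'n \<Rightarrow> real ^ 'n ^ 'n \<Rightarrow> real \<Rightarrow> ((real ^ 'n) \<times> nat) measure" where
  "data_dist \<mu> \<Sigma> \<kappa> =
     Giry_Monad.bind (measure_pmf (pmf_of_set {0, 1}))
       (\<lambda>y. distr (mvn (if y = 1 then \<mu> else - \<mu>) ((1 / \<kappa>) *\<^sub>R \<Sigma>))
                  (borel \<Otimes>\<^sub>M count_space UNIV) (\<lambda>x. (x, y)))"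

text \<open>The i.i.d. sample of size n is a function on {1..n} (extended by undefined).\<close>

definition sample_dist ::
  "real ^ 'n \<Rightarrow> real ^ 'n ^ 'n \<Rightarrow> real \<Rightarrow> nat \<Rightarrow> (nat \<Rightarrow> (real ^ 'n) \<times> nat) measure" where
  "sample_dist \<mu> \<Sigma> \<kappa> n = (\<Pi>\<^sub>M i\<in>{1..n}. data_dist \<mu> \<Sigma> \<kappa>)"

definition logistic_loss :: "real \<Rightarrow> real" where
  "logistic_loss z = ln (1 + exp (- z))"

definition erm_loss :: "nat \<Rightarrow> (nat \<Rightarrow> (real ^ 'n) \<times> nat) \<Rightarrow> real ^ 'n \<Rightarrow> real" where
  "erm_loss n S w = (1 / real n) *
     (\<Sum>i=1..n. case S i of (x, y) \<Rightarrow>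
        real y * logistic_loss (w \<bullet> x) + (1 - real y) * logistic_loss (- (w \<bullet> x)))"

definition unique_minimizer :: "('a \<Rightarrow> real) \<Rightarrow> 'a \<Rightarrow> bool" where
  "unique_minimizer f w \<longleftrightarrow>
     is_arg_min f (\<lambda>_. True) w \<and> (\<forall>v. is_arg_min f (\<lambda>_. True) v \<longrightarrow> v = w)"

definition cos_sim :: "real ^ 'n \<Rightarrow> real ^ 'n \<Rightarrow> real" where
  "cos_sim u v = (u \<bullet> v) / (norm u * norm v)"

end

theory Submission
  imports Defs
begin

text \<open>
  Put \<open>z = x\<close> if \<open>y = 1\<close> and \<open>z = -x\<close> otherwise. Then \<open>z\<close> has distribution
  \<open>N(\<mu>, \<Sigma> / \<kappa>)\<close> and the ERM loss is the mean of \<open>l (w \<bullet> z)\<close>, whose population minimizer is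
  \<open>v = 2 \<kappa> \<Sigma>\<^sup>-\<^sup>1 \<mu>\<close>. It suffices that with high probability the empirical loss exceeds its value
  at \<open>v\<close> on the sphere of radius \<open>\<epsilon> |v| / 2\<close> around \<open>v\<close>; convexity then confines all minimizers
  to the ball. On the sphere the loss is bounded below by a tangent term and a quadratic term. The
  tangent term is governed by the empirical gradient at \<open>v\<close>, which has mean zero. The quadratic term
  is bounded below by counting samples near each coordinate unit vector: every direction has a large
  inner product with one of these vectors, and the Gaussian mass near them is at least
  \<open>exp (-O(\<kappa>))\<close>. Chernoff bounds for the finitely many sums involved conclude.
\<close>

section \<open>Gaussian measures on Euclidean space\<close>

text \<open>The curvature of \<open>logistic_loss\<close> at \<open>z\<close> decays like exp
  (-|z|), so no strong convexity holds globally. Quadratic gain is therefore collected only from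
  samples of norm at most 2, where all arguments stay within 4 |v|. As |v| is proportional to
  \<kappa>, this costs a factor exp (-O(\<kappa>)), the same order as the Gaussian mass of the
  balls. On the sphere of radius r = \<epsilon> |v| / 2 the gain is then of order exp (-O(\<kappa>))
  r^2 and the gradient error at most d r t, so gradient accuracy t of order \<epsilon> exp
  (-O(\<kappa>)) suffices. Chernoff asks for n of order B / t^2 times a logarithm, with an
  exponential moment bound B polynomial in \<kappa>. This amounts to exp (O(\<kappa>)) /
  \<epsilon>^2, which the stated threshold dominates. Two obstacles lie outside these estimates.
  \<open>mvn\<close> is given only by a density, so its total mass must be computed by a linear
  change of variables. And \<open>measure\<close> is 0 on nonmeasurable sets, so the event, which
  quantifies over all \<open>w\<close>, must itself be shown measurable.\<close>

text \<open>Gram-Schmidt for the inner product x . (B y). As long as fewer than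
  \<open>CARD('n)\<close> vectors are chosen, their span is proper, so some vector outside it is
  left to orthogonalise and normalise.\<close>

lemma pos_def_conv_orthonormal_family:
  fixes B :: "real ^ 'n ^ 'n"
  assumes "pos_def B" "k \<le> CARD('n)"
  shows "\<exists>f :: nat \<Rightarrow> real ^ 'n. \<forall>i<k. \<forall>j<k. f i \<bullet> (B *v f j) = (if i = j then 1 else 0)"
  using assms(2)
proof (induction k)
  case (Suc k)
  have sym: "x \<bullet> (B *v y) = y \<bullet> (B *v x)" for x y
    using assms(1) by (metis dot_lmul_matrix inner_commute pos_def_def vector_transpose_matrix)
  obtain f :: "nat \<Rightarrow> real ^ 'n" where f: "\<And>i j. i < k \<Longrightarrow> j < k \<Longrightarrow> f i \<bullet> (B *v f j) = (if i = j then 1 else 0)"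
    using Suc by auto
  have "dim (span (f ` {..<k})) \<le> card (f ` {..<k})"
    by (metis dim_le_card dim_span finite_imageI finite_lessThan order_refl span_superset)
  also have "\<dots> \<le> k" using card_image_le[of "{..<k}" f] by simp
  finally have "dim (span (f ` {..<k})) < dim (UNIV :: (real ^ 'n) set)" using Suc.prems by simp
  hence "span (f ` {..<k}) \<noteq> UNIV" by (metis less_irrefl)
  then obtain x where x: "x \<notin> span (f ` {..<k})" by blast
  define y where "y = x - (\<Sum>i<k. (x \<bullet> (B *v f i)) *\<^sub>R f i)"
  have "(\<Sum>i<k. (x \<bullet> (B *v f i)) *\<^sub>R f i) \<in> span (f ` {..<k})"
    by (intro span_sum span_scale span_base) auto
  hence "y \<noteq> 0" using x by (auto simp: y_def)
  hence pos: "y \<bullet> (B *v y) > 0" using assms(1) by (auto simp: pos_def_def)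
  have orth: "y \<bullet> (B *v f j) = 0" if "j < k" for j
  proof -
    have "y \<bullet> (B *v f j) = x \<bullet> (B *v f j) - (\<Sum>i<k. (x \<bullet> (B *v f i)) * (f i \<bullet> (B *v f j)))"
      by (simp add: y_def inner_diff_left inner_sum_left)
    also have "(\<Sum>i<k. (x \<bullet> (B *v f i)) * (f i \<bullet> (B *v f j))) =
        (\<Sum>i<k. if i = j then x \<bullet> (B *v f i) else 0)"
      by (intro sum.cong) (auto simp: f that)
    finally show ?thesis using that by simp
  qed
  define e where "e = (1 / sqrt (y \<bullet> (B *v y))) *\<^sub>R y"
  have "e \<bullet> (B *v e) = 1"
    using pos by (simp add: e_def matrix_vector_mult_scaleR field_simps)
  moreover have "e \<bullet> (B *v f j) = 0" if "j < k" for j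
    using orth[OF that] by (simp add: e_def)
  ultimately have "\<forall>i<Suc k. \<forall>j<Suc k. (f(k := e)) i \<bullet> (B *v (f(k := e)) j) = (if i = j then 1 else 0)"
    using f sym by (auto simp: less_Suc_eq)
  thus ?case by blast
qed simp

text \<open>A \<open>B\<close>-orthonormal basis forms the columns of \<open>V\<close>, so the
  entries of the product are the \<open>B\<close>-inner products of the basis vectors.\<close>

lemma pos_def_congruent_mat_1:
  fixes B :: "real ^ 'n ^ 'n"
  assumes "pos_def B"
  obtains V :: "real ^ 'n ^ 'n" where "transpose V ** B ** V = mat 1"
proof -
  obtain f :: "nat \<Rightarrow> real ^ 'n" where
    f: "\<And>i j. i < CARD('n) \<Longrightarrow> j < CARD('n) \<Longrightarrow> f i \<bullet> (B *v f j) = (if i = j then 1 else 0)"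
    using pos_def_conv_orthonormal_family[OF assms order_refl] by blast
  obtain h where h: "bij_betw h (UNIV :: 'n set) {0..<CARD('n)}"
    using ex_bij_betw_finite_nat[OF finite] by blast
  define V :: "real ^ 'n ^ 'n" where "V = (\<chi> r c. f (h c) $ r)"
  have "(transpose V ** B ** V) $ i $ j = f (h i) \<bullet> (B *v f (h j))" for i j
    by (simp add: V_def transpose_def matrix_matrix_mult_def matrix_vector_mult_def inner_vec_def
        sum_distrib_left sum_distrib_right mult.assoc)
      (subst sum.swap, simp)
  also have "f (h i) \<bullet> (B *v f (h j)) = (if i = j then 1 else 0)" for i j
  proof -
    have "h i < CARD('n)" "h j < CARD('n)" using h by (auto simp: bij_betw_def)
    moreover have "h i = h j \<longleftrightarrow> i = j" using h by (auto simp: bij_betw_def inj_on_def)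
    ultimately show ?thesis using f by simp
  qed
  finally have "transpose V ** B ** V = mat 1"
    by (simp add: vec_eq_iff mat_def)
  thus ?thesis using that by blast
qed

lemma invertible_matrix_inv:
  fixes A :: "real ^ 'n ^ 'n"
  assumes "invertible A"
  shows "A ** matrix_inv A = mat 1" "matrix_inv A ** A = mat 1"
proof -
  have "A ** matrix_inv A = mat 1 \<and> matrix_inv A ** A = mat 1"
    unfolding matrix_inv_def by (rule someI_ex) (use assms in \<open>simp add: invertible_def\<close>)
  thus "A ** matrix_inv A = mat 1" "matrix_inv A ** A = mat 1" by blast+
qed

lemma matrix_inv_unique:
  fixes A :: "real ^ 'n ^ 'n"
  assumes "A ** B = mat 1"
  shows "matrix_inv A = B"
proof -
  have "invertible A" using assms matrix_left_right_inverse[of A B] unfolding invertible_def by blast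
  hence "B = matrix_inv A ** A ** B" by (simp only: invertible_matrix_inv matrix_mul_lid)
  also have "\<dots> = matrix_inv A" by (simp only: matrix_mul_assoc[symmetric] assms matrix_mul_rid)
  finally show ?thesis ..
qed

lemma pos_def_invertible:
  fixes A :: "real ^ 'n ^ 'n"
  assumes "pos_def A"
  shows "invertible A"
proof -
  have "x = 0" if "A *v x = 0" for x
    using assms that unfolding pos_def_def by (metis inner_zero_right less_irrefl)
  thus ?thesis by (simp only: invertible_left_inverse matrix_left_invertible_ker) blast
qed

lemma pos_def_matrix_inv:
  fixes A :: "real ^ 'n ^ 'n"
  assumes "pos_def A"
  shows "pos_def (matrix_inv A)"
proof -
  note inv = invertible_matrix_inv[OF pos_def_invertible[OF assms]]
  have "A ** transpose (matrix_inv A) = mat 1"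
    using assms matrix_transpose_mul[of "matrix_inv A" A] by (simp add: inv(2) pos_def_def)
  hence sym: "transpose (matrix_inv A) = matrix_inv A" using matrix_inv_unique by metis
  have "x \<bullet> (matrix_inv A *v x) > 0" if "x \<noteq> 0" for x
  proof -
    define y where "y = matrix_inv A *v x"
    have x: "x = A *v y" by (simp add: y_def matrix_vector_mul_assoc inv)
    hence "y \<noteq> 0" using that by auto
    hence "y \<bullet> (A *v y) > 0" using assms by (auto simp: pos_def_def)
    moreover have "x \<bullet> (matrix_inv A *v x) = y \<bullet> (A *v y)"
      unfolding y_def[symmetric] x[symmetric] by (rule inner_commute)
    ultimately show ?thesis by simp
  qed
  thus ?thesis using sym by (simp add: pos_def_def)
qed

lemma pos_def_scaleR: "c > 0 \<Longrightarrow> pos_def A \<Longrightarrow> pos_def (c *\<^sub>R A)"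
  by (auto simp: pos_def_def transpose_def vec_eq_iff scaleR_matrix_vector_assoc[symmetric])

lemma matrix_inv_scaleR:
  fixes A :: "real ^ 'n ^ 'n"
  assumes "c \<noteq> 0" "invertible A"
  shows "matrix_inv (c *\<^sub>R A) = (1 / c) *\<^sub>R matrix_inv A"
proof (intro matrix_inv_unique)
  show "(c *\<^sub>R A) ** ((1 / c) *\<^sub>R matrix_inv A) = mat 1"
    unfolding matrix_eq
    using assms by (simp add: matrix_vector_mul_assoc[symmetric] scaleR_matrix_vector_assoc[symmetric]
      matrix_vector_mult_scaleR) (simp add: matrix_vector_mul_assoc invertible_matrix_inv)
qed

text \<open>\<open>V\<close> replaces a square root of \<open>A\<close>: it turns the quadratic form
  of the inverse into the Euclidean one, and taking determinants gives (det V)^2 = det A, the factor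
  in the normalisation of \<open>mvn_density\<close>.\<close>

lemma pos_def_factor:
  fixes A :: "real ^ 'n ^ 'n"
  assumes "pos_def A"
  obtains V where "transpose V ** matrix_inv A ** V = mat 1" "(det V)\<^sup>2 = det A" "det V \<noteq> 0" "det A > 0"
proof -
  note inv = invertible_matrix_inv[OF pos_def_invertible[OF assms]]
  obtain V :: "real ^ 'n ^ 'n" where V: "transpose V ** matrix_inv A ** V = mat 1"
    using pos_def_congruent_mat_1[OF pos_def_matrix_inv[OF assms]] .
  have "det (transpose V ** matrix_inv A ** V) = 1" by (simp add: V)
  hence 1: "(det V)\<^sup>2 * det (matrix_inv A) = 1"
    by (simp add: det_mul power2_eq_square mult_ac)
  have 2: "det (matrix_inv A) * det A = 1"
    using det_mul[of "matrix_inv A" A] inv(2) by simp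
  have "(det V)\<^sup>2 = (det V)\<^sup>2 * (det (matrix_inv A) * det A)" by (simp add: 2)
  also have "\<dots> = det A" unfolding mult.assoc[symmetric] 1 by simp
  finally have 3: "(det V)\<^sup>2 = det A" .
  have "det V \<noteq> 0" using 1 by auto
  moreover from this have "det A > 0" unfolding 3[symmetric] by simp
  ultimately show ?thesis using that V 3 by blast
qed

section \<open>Linear change of variables for Lebesgue measure\<close>

text \<open>Lebesgue measure is determined by boxes. The scaling rule \<open>im\<close> extends from
  boxes to all measurable sets by \<open>measure_linear_sufficient\<close>; it is applied to the
  preimage of a box, which is open and bounded.\<close>

lemma nn_integral_lborel_linear:
  fixes f :: "real ^ 'n \<Rightarrow> real ^ 'n"
  assumes f: "linear f" "inj f" and c: "c > 0"
    and im: "\<And>a b. measure lebesgue (f ` cbox a b) = c * measure lebesgue (cbox a b)"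
    and g: "g \<in> borel_measurable borel"
  shows "(\<integral>\<^sup>+x. g x \<partial>lborel) = ennreal c * (\<integral>\<^sup>+u. g (f u) \<partial>lborel)"
proof -
  have cont: "continuous_on UNIV f" using f by (simp add: linear_continuous_on linear_linear)
  hence [measurable]: "f \<in> borel \<rightarrow>\<^sub>M borel" by (rule borel_measurable_continuous_onI)
  obtain h where h: "linear h" "\<And>x. h (f x) = x" "\<And>x. f (h x) = x"
    using f linear_injective_isomorphism by blast
  have "lborel = density (distr lborel borel f) (\<lambda>_. ennreal c)"
  proof (rule lborel_eqI)
    fix l u :: "real ^ 'n" assume le: "\<And>b. b \<in> Basis \<Longrightarrow> l \<bullet> b \<le> u \<bullet> b"
    have vi: "f -` box l u = h ` box l u" using h by (auto simp: image_iff) metis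
    have op: "open (f -` box l u)" using cont by (simp add: continuous_on_open_vimage open_box)
    have "bounded (f -` box l u)" unfolding vi by (intro bounded_linear_image) (auto simp: h linear_linear)
    hence lm: "f -` box l u \<in> lmeasurable" using op by (simp add: lmeasurable_open)
    have "c * measure lebesgue (f -` box l u) = measure lebesgue (f ` (f -` box l u))"
      using measure_linear_sufficient[OF f(1) lm im] by simp
    also have "f ` (f -` box l u) = box l u" using h by (auto simp: image_iff) metis
    finally have "c * measure lebesgue (f -` box l u) = measure lborel (box l u)" by simp
    moreover have "emeasure lebesgue (f -` box l u) = ennreal (measure lebesgue (f -` box l u))"
      using lm by (subst emeasure_eq_ennreal_measure) (auto simp: fmeasurable_def)
    ultimately show "emeasure (density (distr lborel borel f) (\<lambda>_. ennreal c)) (box l u) = (\<Prod>b\<in>Basis. (u - l) \<bullet> b)"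
      using le c op by (simp add: emeasure_density nn_integral_cmult emeasure_distr
        ennreal_mult[symmetric] measure_lborel_box_eq inner_diff_left)
  qed simp
  hence "(\<integral>\<^sup>+x. g x \<partial>lborel) = (\<integral>\<^sup>+x. g x \<partial>density (distr lborel borel f) (\<lambda>_. ennreal c))" by simp
  also have "\<dots> = ennreal c * (\<integral>\<^sup>+u. g (f u) \<partial>lborel)"
    using g by (simp add: nn_integral_density nn_integral_distr nn_integral_cmult)
  finally show ?thesis .
qed

lemma nn_integral_lborel_shear:
  fixes m n :: "'n :: finite" and g :: "real ^ 'n \<Rightarrow> ennreal"
  assumes "m \<noteq> n" "g \<in> borel_measurable borel"
  shows "(\<integral>\<^sup>+x. g x \<partial>lborel) = (\<integral>\<^sup>+x. g (\<chi> i. if i = m then x $ m + x $ n else x $ i) \<partial>lborel)"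
proof -
  define f where "f = (\<lambda>x :: real ^ 'n. \<chi> i. if i = m then x $ m + x $ n else x $ i)"
  have lin: "linear f"
    by (rule linearI) (auto simp: f_def algebra_simps plus_vec_def scaleR_vec_def vec_eq_iff)
  have inj: "inj f"
    by (rule inj_on_inverseI[of _ "\<lambda>x. \<chi> i. if i = m then x $ m - x $ n else x $ i"])
      (use assms(1) in \<open>simp add: f_def vec_eq_iff\<close>)
  have "measure lebesgue (f ` cbox a b) = measure lebesgue (cbox a b)" for a b
  proof (cases "cbox a b = {}")
    case False
    hence ne: "cbox 0 (b - a) \<noteq> {}"
      by (simp add: box_ne_empty inner_diff_left)
    \<comment> \<open>Translating the lower corner to 0 makes the remaining premise of
      \<open>measure_shear_interval\<close>, a sign condition on that corner, trivial.\<close>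
    have cb: "cbox a b = (\<lambda>x. a + x) ` cbox 0 (b - a)"
      using cbox_translation[of a 0 "b - a"] by simp
    have "f ` cbox a b = (\<lambda>x. f a + x) ` f ` cbox 0 (b - a)"
      unfolding cb by (simp add: image_image linear_add[OF lin])
    hence "measure lebesgue (f ` cbox a b) = measure lebesgue (f ` cbox 0 (b - a))"
      by (simp add: measure_translation)
    also have "\<dots> = measure lebesgue (cbox 0 (b - a))"
      unfolding f_def by (rule measure_shear_interval[OF assms(1) ne]) simp
    also have "\<dots> = measure lebesgue (cbox a b)"
      unfolding cb by (simp only: measure_translation)
    finally show ?thesis .
  qed simp
  thus ?thesis
    using nn_integral_lborel_linear[OF lin inj, of 1 g] assms(2) by (simp add: f_def)
qed

lemma nn_integral_lborel_swap:
  fixes m n :: "'n :: finite" and g :: "real ^ 'n \<Rightarrow> ennreal"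
  assumes "g \<in> borel_measurable borel"
  shows "(\<integral>\<^sup>+x. g x \<partial>lborel) = (\<integral>\<^sup>+x. g (\<chi> i. x $ Transposition.transpose m n i) \<partial>lborel)"
proof -
  define f where "f = (\<lambda>x :: real ^ 'n. \<chi> i. x $ Transposition.transpose m n i)"
  have lin: "linear f"
    by (rule linearI) (auto simp: f_def vec_eq_iff)
  have ff: "f (f x) = x" for x by (simp add: f_def vec_eq_iff)
  hence inj: "inj f" by (metis injI)
  have cb: "f x \<in> cbox (f a) (f b) \<longleftrightarrow> x \<in> cbox a b" for x a b
    unfolding mem_box_cart f_def vec_lambda_beta by (metis transpose_involutory)
  have "measure lebesgue (f ` cbox a b) = measure lebesgue (cbox a b)" for a b
  proof -
    have im: "f ` cbox a b = cbox (f a) (f b)"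
      using cb by (auto simp: image_iff) (metis ff)
    show ?thesis
    proof (cases "cbox a b = {}")
      case False
      hence "cbox (f a) (f b) \<noteq> {}" using im by auto
      thus ?thesis using False unfolding im
        by (simp add: content_cbox_cart f_def)
          (rule prod.reindex_bij_betw[of "Transposition.transpose m n" UNIV UNIV "\<lambda>i. b $ i - a $ i"], simp)
    qed simp
  qed
  thus ?thesis
    using nn_integral_lborel_linear[OF lin inj, of 1 g] assms by (simp add: f_def)
qed

text \<open>Both sides are multiplicative in \<open>A\<close>, so elementary matrices suffice. The
  induction carries all \<open>g\<close> at once, because the product case uses the hypothesis for
  \<open>B\<close> at the function \<open>g\<close> composed with \<open>A\<close>. A zero row
  contradicts the determinant condition.\<close>

lemma nn_integral_lborel_matrix:
  fixes A :: "real ^ 'n ^ 'n"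
  assumes "det A \<noteq> 0" "g \<in> borel_measurable borel"
  shows "(\<integral>\<^sup>+x. g x \<partial>lborel) = ennreal \<bar>det A\<bar> * (\<integral>\<^sup>+u. g (A *v u) \<partial>lborel)"
proof -
  have meas: "(\<lambda>u. g (A *v u)) \<in> borel_measurable borel"
    if "g \<in> borel_measurable borel" for g :: "real ^ 'n \<Rightarrow> ennreal" and A :: "real ^ 'n ^ 'n"
    by (rule measurable_compose[OF borel_measurable_continuous_onI that])
      (simp add: linear_continuous_on)
  have "det A \<noteq> 0 \<longrightarrow> (\<forall>g\<in>borel_measurable borel.
    (\<integral>\<^sup>+x. g x \<partial>lborel) = ennreal \<bar>det A\<bar> * (\<integral>\<^sup>+u. g (A *v u) \<partial>lborel))"
  proof (induction A rule: induct_matrix_elementary_alt)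
    case (1 A B)
    show ?case
    proof (intro impI ballI)
      fix g :: "real ^ 'n \<Rightarrow> ennreal" assume "det (A ** B) \<noteq> 0" and g: "g \<in> borel_measurable borel"
      hence d: "det A \<noteq> 0" "det B \<noteq> 0" by (auto simp: det_mul)
      have "(\<integral>\<^sup>+x. g x \<partial>lborel) = ennreal \<bar>det A\<bar> * (\<integral>\<^sup>+u. g (A *v u) \<partial>lborel)"
        using 1 d g by blast
      also have "(\<integral>\<^sup>+u. g (A *v u) \<partial>lborel) = ennreal \<bar>det B\<bar> * (\<integral>\<^sup>+u. g (A *v (B *v u)) \<partial>lborel)"
        using 1(2) d(2) meas[OF g, of A] by blast
      finally show "(\<integral>\<^sup>+x. g x \<partial>lborel) = ennreal \<bar>det (A ** B)\<bar> * (\<integral>\<^sup>+u. g (A ** B *v u) \<partial>lborel)"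
        by (simp add: det_mul abs_mult ennreal_mult matrix_vector_mul_assoc mult.assoc)
    qed
  next
    case (2 A i)
    thus ?case by (simp add: det_zero_row(2))
  next
    case (3 A)
    have B: "(Basis :: (real ^ 'n) set) = (\<lambda>i. axis i 1) ` UNIV" by (auto simp: Basis_vec_def)
    have inj: "inj (\<lambda>i :: 'n. axis i (1 :: real))" by (auto simp: inj_def axis_eq_axis)
    have ax: "(\<Sum>i\<in>UNIV. A $ i $ i * axis k 1 $ i) = A $ k $ k" for k
      by (simp add: axis_def if_distrib cong: if_cong)
    \<comment> \<open>The shape demanded by \<open>lborel_affine_euclidean\<close>: the inner sum
      picks out the diagonal entry belonging to the basis vector \<open>j\<close>.\<close>
    have eq: "A *v u = (\<Sum>j\<in>Basis. ((\<Sum>i\<in>UNIV. A $ i $ i * j $ i) * (u \<bullet> j)) *\<^sub>R j)" for u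
    proof -
      have "(A *v u) $ k = A $ k $ k * u $ k" for k
      proof -
        have "(A *v u) $ k = (\<Sum>j\<in>UNIV. A $ k $ j * u $ j)"
          by (simp add: matrix_vector_mult_def)
        also have "\<dots> = (\<Sum>j\<in>UNIV. if j = k then A $ k $ k * u $ k else 0)"
          by (intro sum.cong) (auto simp: 3)
        finally show ?thesis by simp
      qed
      moreover have "(\<Sum>j\<in>Basis. ((\<Sum>i\<in>UNIV. A $ i $ i * j $ i) * (u \<bullet> j)) *\<^sub>R j) =
          (\<Sum>i\<in>UNIV. (A $ i $ i * u $ i) *\<^sub>R axis i 1)"
        unfolding B by (subst sum.reindex[OF inj]) (simp add: ax inner_axis)
      ultimately show ?thesis
        by (simp add: vec_eq_iff axis_def if_distrib cong: if_cong)
    qed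
    show ?case
    proof (intro impI ballI)
      fix g :: "real ^ 'n \<Rightarrow> ennreal" assume d: "det A \<noteq> 0" and g: "g \<in> borel_measurable borel"
      have dA: "det A = (\<Prod>i\<in>UNIV. A $ i $ i)" by (rule det_diagonal) (rule 3)
      have nz: "A $ i $ i \<noteq> 0" for i using d by (auto simp: dA)
      have [measurable]: "(\<lambda>u. A *v u) \<in> borel \<rightarrow>\<^sub>M borel"
        by (intro borel_measurable_continuous_onI) (simp add: linear_continuous_on)
      have nz0: "(\<Sum>i\<in>UNIV. A $ i $ i * j $ i) \<noteq> 0" if "j \<in> Basis" for j
        using that nz unfolding B by (auto simp: ax)
      have pr: "(\<Prod>j\<in>Basis. \<bar>\<Sum>i\<in>UNIV. A $ i $ i * j $ i\<bar>) = \<bar>det A\<bar>"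
        using dA unfolding B by (subst prod.reindex[OF inj]) (simp add: ax abs_prod)
      have "lborel = density (distr lborel borel (\<lambda>u. A *v u)) (\<lambda>_. ennreal \<bar>det A\<bar>)"
        using lborel_affine_euclidean[of "\<lambda>j. \<Sum>i\<in>UNIV. A $ i $ i * j $ i" 0] nz0
        by (simp add: eq[symmetric] pr)
      hence "(\<integral>\<^sup>+x. g x \<partial>lborel) = (\<integral>\<^sup>+x. g x \<partial>density (distr lborel borel (\<lambda>u. A *v u)) (\<lambda>_. ennreal \<bar>det A\<bar>))"
        by simp
      thus "(\<integral>\<^sup>+x. g x \<partial>lborel) = ennreal \<bar>det A\<bar> * (\<integral>\<^sup>+u. g (A *v u) \<partial>lborel)"
        using g by (simp add: nn_integral_density nn_integral_distr nn_integral_cmult)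
    qed
  next
    case (4 m n)
    let ?A = "(\<chi> i j. mat 1 $ i $ Transposition.transpose m n j) :: real ^ 'n ^ 'n"
    have "mat 1 $ i $ Transposition.transpose m n j = (if j = Transposition.transpose m n i then 1 else (0 :: real))" for i j
      by (auto simp: mat_def)
    hence eq: "?A *v u = (\<chi> i. u $ Transposition.transpose m n i)" for u
      by (simp add: vec_eq_iff matrix_vector_mult_def if_distrib[of "\<lambda>x. x * _"] cong: if_cong)
    have "?A ** ?A = mat 1"
      by (simp add: matrix_eq matrix_vector_mul_assoc[symmetric] eq vec_eq_iff)
    hence "det ?A * det ?A = 1" by (metis det_I det_mul)
    hence "\<bar>det ?A\<bar> = 1" unfolding power2_eq_square[symmetric] power2_eq_1_iff by auto
    thus ?case by (simp only: eq) (simp add: nn_integral_lborel_swap[of _ m n, symmetric])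
  next
    case (5 m n)
    let ?A = "(\<chi> i j. of_bool (i = m \<and> j = n \<or> i = j)) :: real ^ 'n ^ 'n"
    have A: "?A = (\<chi> k. if k = m then row m (mat 1) + 1 *s row n (mat 1) else row k (mat 1))"
      using 5 by (auto simp: vec_eq_iff row_def mat_def)
    have "det ?A = 1" unfolding A by (subst det_row_operation[OF 5]) simp
    moreover have "?A *v u = (\<chi> i. if i = m then u $ m + u $ n else u $ i)" for u
      using 5 unfolding A by (auto simp: vec_eq_iff matrix_vector_mult_def row_def mat_def algebra_simps sum.distrib if_distrib[of "\<lambda>x. _ * x"] cong: if_cong)
    ultimately show ?case
      using nn_integral_lborel_shear[OF 5] by simp
  qed
  thus ?thesis using assms by blast
qed

section \<open>Normalisation of the Gaussian density\<close>

lemma nn_integral_std_normal_vec: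
  "(\<integral>\<^sup>+u. ennreal (exp (- (u \<bullet> u) / 2)) \<partial>(lborel :: (real ^ 'n) measure)) = ennreal (sqrt ((2 * pi) ^ CARD('n)))"
proof -
  have "exp (- (u \<bullet> u) / 2) = (\<Prod>b\<in>Basis. sqrt (2 * pi) * std_normal_density (u \<bullet> b))" for u :: "real ^ 'n"
  proof -
    have "- (u \<bullet> u) / 2 = (\<Sum>b\<in>Basis. - (u \<bullet> b)\<^sup>2 / 2)"
      by (subst euclidean_inner) (simp add: power2_eq_square sum_negf sum_divide_distrib)
    thus ?thesis by (simp add: exp_sum std_normal_density_def)
  qed
  hence "(\<integral>\<^sup>+u. ennreal (exp (- (u \<bullet> u) / 2)) \<partial>(lborel :: (real ^ 'n) measure)) =
      (\<integral>\<^sup>+u. (\<Prod>b\<in>Basis. ennreal (sqrt (2 * pi) * std_normal_density (u \<bullet> b))) \<partial>(lborel :: (real ^ 'n) measure))"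
    by (simp add: prod_ennreal)
  also have "\<dots> = (\<Prod>b\<in>(Basis :: (real ^ 'n) set). \<integral>\<^sup>+x. ennreal (sqrt (2 * pi) * std_normal_density x) \<partial>lborel)"
    by (rule nn_integral_lborel_prod) auto
  also have "(\<integral>\<^sup>+x. ennreal (sqrt (2 * pi) * std_normal_density x) \<partial>lborel) = ennreal (sqrt (2 * pi))"
    by (subst nn_integral_eq_integral) (auto intro!: integrable_mult_right)
  finally show ?thesis by (simp add: real_sqrt_power[symmetric] prod_ennreal ennreal_power)
qed

lemma pos_def_det: "pos_def A \<Longrightarrow> det A > 0"
  by (erule pos_def_factor)

lemma mvn_density_pos: "pos_def A \<Longrightarrow> mvn_density m A x > 0"
  using pos_def_det[of A] by (auto simp: mvn_density_def intro!: divide_pos_pos mult_pos_pos)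

lemma borel_measurable_mvn_density [measurable]: "mvn_density m A \<in> borel_measurable borel"
proof -
  have [measurable]: "(\<lambda>x. matrix_inv A *v x) \<in> borel \<rightarrow>\<^sub>M borel"
    by (rule borel_measurable_continuous_onI) (rule matrix_vector_mult_linear_continuous_on)
  have [measurable]: "(\<lambda>x. matrix_inv A *v (x - m)) \<in> borel \<rightarrow>\<^sub>M borel"
    by (rule measurable_compose[of "\<lambda>x. x - m" _ borel]) measurable
  show ?thesis
    unfolding mvn_density_def[abs_def] by measurable
qed

text \<open>Substituting x = m + V u turns the exponent into -|u|^2 / 2, and the Jacobian |det V|
  cancels the factor sqrt (det A).\<close>

lemma nn_integral_mvn_density:
  fixes A :: "real ^ 'n ^ 'n"
  assumes "pos_def A"
  shows "(\<integral>\<^sup>+x. ennreal (mvn_density m A x) \<partial>lborel) = 1"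
proof -
  obtain V where V: "transpose V ** matrix_inv A ** V = mat 1" "(det V)\<^sup>2 = det A" "det V \<noteq> 0" "det A > 0"
    using pos_def_factor[OF assms] .
  have [measurable]: "(\<lambda>u. V *v u) \<in> borel \<rightarrow>\<^sub>M borel"
    by (rule borel_measurable_continuous_onI) (rule matrix_vector_mult_linear_continuous_on)
  have [simp]: "(V *v u) \<bullet> (matrix_inv A *v (V *v u)) = u \<bullet> u" for u
  proof -
    have "(V *v u) \<bullet> (matrix_inv A *v (V *v u)) = u \<bullet> ((transpose V ** matrix_inv A ** V) *v u)"
      by (simp only: matrix_vector_mul_assoc[symmetric] transpose_matrix_vector inner_commute[of u] dot_lmul_matrix)
        (rule inner_commute)
    thus ?thesis by (simp add: V(1))
  qed
  define N where "N = sqrt ((2 * pi) ^ CARD('n))"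
  have N: "N > 0" by (simp add: N_def)
  have sq: "sqrt ((2 * pi) ^ CARD('n) * det A) = N * \<bar>det V\<bar>"
    by (simp add: V(2)[symmetric] real_sqrt_mult N_def)
  have "(\<integral>\<^sup>+x. ennreal (mvn_density m A x) \<partial>lborel) =
     (\<integral>\<^sup>+u. ennreal \<bar>det V\<bar> * ennreal (mvn_density m A (m + V *v u)) \<partial>lborel)"
    proof -
    have "lborel = distr lborel borel (\<lambda>x :: real ^ 'n. m + x)"
      by (simp add: lborel_distr_plus)
    hence "(\<integral>\<^sup>+x. ennreal (mvn_density m A x) \<partial>lborel) =
        (\<integral>\<^sup>+x. ennreal (mvn_density m A x) \<partial>distr lborel borel (\<lambda>x. m + x))" by simp
    also have "\<dots> = (\<integral>\<^sup>+x. ennreal (mvn_density m A (m + x)) \<partial>lborel)"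
      by (simp add: nn_integral_distr)
    also have "\<dots> = ennreal \<bar>det V\<bar> * (\<integral>\<^sup>+u. ennreal (mvn_density m A (m + V *v u)) \<partial>lborel)"
      by (rule nn_integral_lborel_matrix[OF V(3)]) simp
    also have "\<dots> = (\<integral>\<^sup>+u. ennreal \<bar>det V\<bar> * ennreal (mvn_density m A (m + V *v u)) \<partial>lborel)"
      by (rule nn_integral_cmult[symmetric]) measurable
    finally show ?thesis .
  qed
  also have "\<dots> = (\<integral>\<^sup>+u. ennreal (1 / N) * ennreal (exp (- (u \<bullet> u) / 2)) \<partial>(lborel :: (real ^ 'n) measure))"
    using V(3) N unfolding mvn_density_def sq
    by (intro nn_integral_cong) (simp add: ennreal_mult[symmetric] field_simps)
  also have "\<dots> = ennreal (1 / N) * ennreal N"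
    unfolding N_def nn_integral_std_normal_vec[symmetric] by (rule nn_integral_cmult) measurable
  also have "\<dots> = 1" using N by (simp add: ennreal_mult[symmetric])
  finally show ?thesis .
qed

lemma prob_space_mvn: "pos_def A \<Longrightarrow> prob_space (mvn m A)"
  by (auto simp: mvn_def emeasure_density nn_integral_mvn_density intro!: prob_spaceI)

lemma sets_mvn [simp, measurable_cong]: "sets (mvn m A) = sets borel"
  and space_mvn [simp]: "space (mvn m A) = UNIV"
  by (auto simp: mvn_def)

section \<open>The signed feature distribution\<close>

definition signed_feature :: "(real ^ 'n) \<times> nat \<Rightarrow> real ^ 'n" where
  "signed_feature p = (if snd p = 1 then fst p else - fst p)"

lemma measurable_signed_feature [measurable]:
  "signed_feature \<in> borel \<Otimes>\<^sub>M count_space UNIV \<rightarrow>\<^sub>M borel"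
  unfolding signed_feature_def[abs_def] by measurable

lemma distr_lborel_uminus: "distr lborel borel uminus = (lborel :: 'a :: euclidean_space measure)"
  using lborel_affine[of "-1" "0 :: 'a"] by (simp add: density_1)

text \<open>The quadratic form is even. This folds the class with label 0 onto the class with label
  1, so that one Gaussian describes all signed samples.\<close>

lemma mvn_reflect:
  assumes "pos_def A"
  shows "distr (mvn (- m) A) borel uminus = mvn m A"
proof (rule measure_eqI)
  fix X assume "X \<in> sets (distr (mvn (- m) A) borel uminus)"
  hence [measurable]: "X \<in> sets borel" by simp
  have "- x - - m = - (x - m)" for x by simp
  hence "mvn_density (- m) A (- x) = mvn_density m A x" for x
    by (simp only: mvn_density_def linear_neg[OF matrix_vector_mul_linear] inner_minus_left inner_minus_right minus_minus)
  hence "emeasure (mvn m A) X = (\<integral>\<^sup>+x. ennreal (mvn_density (- m) A (- x)) * indicator X x \<partial>lborel)"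
    by (simp add: mvn_def emeasure_density)
  also have "\<dots> = (\<integral>\<^sup>+x. ennreal (mvn_density (- m) A (- x)) * indicator X x \<partial>distr lborel borel uminus)"
    by (simp add: distr_lborel_uminus)
  also have "\<dots> = (\<integral>\<^sup>+x. ennreal (mvn_density (- m) A x) * indicator X (- x) \<partial>lborel)"
    by (subst nn_integral_distr) simp_all
  also have "\<dots> = emeasure (mvn (- m) A) (uminus -` X)"
    using measurable_sets[of uminus borel borel X]
    by (simp add: mvn_def emeasure_density indicator_vimage)
  also have "\<dots> = emeasure (distr (mvn (- m) A) borel uminus) X"
    by (subst emeasure_distr) simp_all
  finally show "emeasure (distr (mvn (- m) A) borel uminus) X = emeasure (mvn m A) X" ..
qed simp

context
  fixes \<mu> :: "real ^ 'n" and \<Sigma> :: "real ^ 'n ^ 'n" and \<kappa> :: real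
  assumes \<Sigma>: "pos_def \<Sigma>" and \<kappa>: "\<kappa> > 0"
begin

lemma pos_def_cov: "pos_def ((1 / \<kappa>) *\<^sub>R \<Sigma>)"
  using \<Sigma> \<kappa> by (simp add: pos_def_scaleR)

lemma prob_space_class_dist:
  "prob_space (distr (mvn m ((1 / \<kappa>) *\<^sub>R \<Sigma>)) (borel \<Otimes>\<^sub>M count_space UNIV) (\<lambda>x. (x, y :: nat)))"
  by (intro prob_space.prob_space_distr prob_space_mvn pos_def_cov) simp

lemma class_dist_kernel:
  "(\<lambda>y. distr (mvn (if y = 1 then \<mu> else - \<mu>) ((1 / \<kappa>) *\<^sub>R \<Sigma>)) (borel \<Otimes>\<^sub>M count_space UNIV) (\<lambda>x. (x, y)))
     \<in> measure_pmf (pmf_of_set {0, 1 :: nat}) \<rightarrow>\<^sub>M subprob_algebra (borel \<Otimes>\<^sub>M count_space UNIV)"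
  by (auto simp: space_subprob_algebra intro!: prob_space_imp_subprob_space prob_space_class_dist)

lemma prob_space_data_dist: "prob_space (data_dist \<mu> \<Sigma> \<kappa>)"
  unfolding data_dist_def
  by (rule measure_pmf.prob_space_bind[OF _ class_dist_kernel]) (intro AE_I2 prob_space_class_dist)

lemma sets_data_dist: "sets (data_dist \<mu> \<Sigma> \<kappa>) = sets (borel \<Otimes>\<^sub>M count_space UNIV)"
  unfolding data_dist_def by (rule sets_bind) auto

lemma nn_integral_data_dist:
  assumes [measurable]: "f \<in> borel_measurable (borel \<Otimes>\<^sub>M count_space UNIV)"
  shows "(\<integral>\<^sup>+p. f p \<partial>data_dist \<mu> \<Sigma> \<kappa>) =
    ((\<integral>\<^sup>+x. f (x, 0) \<partial>mvn (- \<mu>) ((1 / \<kappa>) *\<^sub>R \<Sigma>)) + (\<integral>\<^sup>+x. f (x, 1) \<partial>mvn \<mu> ((1 / \<kappa>) *\<^sub>R \<Sigma>))) / 2"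
  unfolding data_dist_def
  by (subst nn_integral_bind[OF assms class_dist_kernel])
    (simp add: nn_integral_pmf_of_set nn_integral_distr)

lemma distr_signed_feature:
  "distr (data_dist \<mu> \<Sigma> \<kappa>) borel signed_feature = mvn \<mu> ((1 / \<kappa>) *\<^sub>R \<Sigma>)"
proof (rule measure_eqI)
  note [measurable_cong] = sets_data_dist
  have meas [measurable]: "signed_feature \<in> data_dist \<mu> \<Sigma> \<kappa> \<rightarrow>\<^sub>M borel" by measurable
  fix X assume "X \<in> sets (distr (data_dist \<mu> \<Sigma> \<kappa>) borel signed_feature)"
  hence [measurable]: "X \<in> sets borel" by simp
  let ?N = "mvn \<mu> ((1 / \<kappa>) *\<^sub>R \<Sigma>)"
  have "emeasure (distr (data_dist \<mu> \<Sigma> \<kappa>) borel signed_feature) X =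
      (\<integral>\<^sup>+p. indicator X (signed_feature p) \<partial>data_dist \<mu> \<Sigma> \<kappa>)"
    by (subst nn_integral_distr[symmetric, OF meas]) simp_all
  also have "\<dots> = ((\<integral>\<^sup>+x. indicator X (- x) \<partial>mvn (- \<mu>) ((1 / \<kappa>) *\<^sub>R \<Sigma>)) + (\<integral>\<^sup>+x. indicator X x \<partial>?N)) / 2"
    by (subst nn_integral_data_dist) (auto simp: signed_feature_def)
  also have "(\<integral>\<^sup>+x. indicator X (- x) \<partial>mvn (- \<mu>) ((1 / \<kappa>) *\<^sub>R \<Sigma>)) =
      (\<integral>\<^sup>+x. indicator X x \<partial>distr (mvn (- \<mu>) ((1 / \<kappa>) *\<^sub>R \<Sigma>)) borel uminus)"
    by (subst nn_integral_distr) simp_all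
  also have "\<dots> = emeasure ?N X" by (simp add: mvn_reflect pos_def_cov)
  also have "(\<integral>\<^sup>+x. indicator X x \<partial>?N) = emeasure ?N X" by simp
  also have "(emeasure ?N X + emeasure ?N X) / 2 = emeasure ?N X"
    by (simp add: mult_2_right[symmetric] mult_divide_eq_ennreal)
  finally show "emeasure (distr (data_dist \<mu> \<Sigma> \<kappa>) borel signed_feature) X = emeasure ?N X" .
qed simp

text \<open>The sample space contains every natural number as a label, but the ERM loss is a mean of
  logistic losses of signed features only for labels 0 and 1. This discards the other samples as a
  null set.\<close>

lemma AE_data_dist_label: "AE p in data_dist \<mu> \<Sigma> \<kappa>. snd p = 0 \<or> snd p = 1"
proof -
  have "AE x in measure_pmf (pmf_of_set {0, 1 :: nat}). x \<in> {0, 1}"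
    by (rule AE_pmfI) simp
  thus ?thesis
    unfolding data_dist_def
    by (subst AE_bind[OF class_dist_kernel]) (auto simp: AE_distr_iff elim!: eventually_mono)
qed

end

section \<open>A Chernoff bound\<close>

text \<open>Lagrange remainder: since \<open>s\<close> is at most 1/2, the intermediate exponential
  is at most exp (|x| / 2), and x^2 is at most 8 exp (|x| / 2). Their product is 8 exp |x|, halved
  by the factorial.\<close>

lemma exp_mult_le_quadratic:
  fixes s x :: real
  assumes "0 \<le> s" "s \<le> 1 / 2"
  shows "exp (s * x) \<le> 1 + s * x + 4 * s\<^sup>2 * exp \<bar>x\<bar>"
proof -
  obtain t where t: "\<bar>t\<bar> \<le> \<bar>s * x\<bar>" "exp (s * x) = (\<Sum>m<2. (s * x) ^ m / fact m) + exp t / fact 2 * (s * x) ^ 2"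
    using Maclaurin_exp_le by blast
  define e where "e = exp (\<bar>x\<bar> / 2)"
  have ee: "e * e = exp \<bar>x\<bar>" by (simp add: e_def exp_add[symmetric])
  have "\<bar>s * x\<bar> \<le> \<bar>x\<bar> / 2"
    using assms mult_right_mono[of s "1/2" "\<bar>x\<bar>"] by (simp add: abs_mult)
  hence "exp t \<le> e" using t(1) by (simp add: e_def)
  moreover have "x\<^sup>2 \<le> 8 * e"
    using exp_lower_Taylor_quadratic[of "\<bar>x\<bar> / 2"] by (simp add: e_def power_divide)
  ultimately have "exp t * x\<^sup>2 \<le> e * (8 * e)"
    by (intro mult_mono) (auto simp: e_def)
  hence "s\<^sup>2 * (exp t * x\<^sup>2) \<le> s\<^sup>2 * (8 * exp \<bar>x\<bar>)"
    by (intro mult_left_mono) (auto simp: ee[symmetric] mult_ac)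
  moreover have "exp (s * x) = 1 + s * x + s\<^sup>2 * (exp t * x\<^sup>2) / 2"
    using t(2) by (simp add: numeral_2_eq_2 power_mult_distrib field_simps)
  ultimately show ?thesis by (simp add: field_simps)
qed

text \<open>Integrating the quadratic bound, the linear term vanishes because \<open>X\<close> is
  centred, and 1 + y is at most exp y.\<close>

lemma (in prob_space) mgf_le:
  fixes X :: "'a \<Rightarrow> real"
  assumes [measurable]: "X \<in> borel_measurable M"
    and "expectation X = 0" and B: "(\<integral>\<^sup>+x. ennreal (exp \<bar>X x\<bar>) \<partial>M) \<le> ennreal B"
    and s: "0 \<le> s" "s \<le> 1 / 2"
  shows "(\<integral>\<^sup>+x. ennreal (exp (s * X x)) \<partial>M) \<le> ennreal (exp (4 * s\<^sup>2 * B))"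
proof -
  have int: "integrable M (\<lambda>x. exp \<bar>X x\<bar>)"
    by (rule integrableI_bounded) (use B in \<open>auto intro: le_less_trans\<close>)
  have intX: "integrable M X"
    by (rule Bochner_Integration.integrable_bound[OF int]) (auto intro: less_imp_le exp_gt_self order_trans[OF _ less_imp_le[OF exp_gt_self]])
  have "ennreal (expectation (\<lambda>x. exp \<bar>X x\<bar>)) \<le> ennreal B"
    using B by (subst (asm) nn_integral_eq_integral[OF int]) auto
  \<comment> \<open>\<open>ennreal B\<close> is 0 for negative \<open>B\<close>. That the moment is
    at least 1 rules this out and lets the bound pass to the reals.\<close>
  moreover have "expectation (\<lambda>x. exp \<bar>X x\<bar>) \<ge> 1"
    using integral_mono[OF _ int, of "\<lambda>_. 1"] by (simp add: prob_space)
  ultimately have EB: "expectation (\<lambda>x. exp \<bar>X x\<bar>) \<le> B"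
    by (metis ennreal_le_iff2 not_one_le_zero order_trans)
  have "(\<integral>\<^sup>+x. ennreal (exp (s * X x)) \<partial>M) \<le> (\<integral>\<^sup>+x. ennreal (1 + s * X x + 4 * s\<^sup>2 * exp \<bar>X x\<bar>) \<partial>M)"
    by (intro nn_integral_mono ennreal_leI exp_mult_le_quadratic s)
  also have "\<dots> = ennreal (expectation (\<lambda>x. 1 + s * X x + 4 * s\<^sup>2 * exp \<bar>X x\<bar>))"
    using int intX order_trans[OF less_imp_le[OF exp_gt_zero] exp_mult_le_quadratic[OF s]]
    by (intro nn_integral_eq_integral) auto
  also have "expectation (\<lambda>x. 1 + s * X x + 4 * s\<^sup>2 * exp \<bar>X x\<bar>) = 1 + 4 * s\<^sup>2 * expectation (\<lambda>x. exp \<bar>X x\<bar>)"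
    using int intX assms(2) by (simp add: prob_space)
  also have "\<dots> \<le> 1 + 4 * s\<^sup>2 * B"
    using EB by (intro add_left_mono mult_left_mono) auto
  also have "\<dots> \<le> exp (4 * s\<^sup>2 * B)" by (rule exp_ge_add_one_self)
  finally show ?thesis by (simp add: ennreal_leI)
qed

lemma (in prob_space) chernoff_iid_sum:
  fixes X :: "'a \<Rightarrow> real" and I :: "'i set"
  assumes I: "finite I" and X [measurable]: "X \<in> borel_measurable M"
    and EX: "expectation X = 0" and B: "(\<integral>\<^sup>+x. ennreal (exp \<bar>X x\<bar>) \<partial>M) \<le> ennreal B"
    and a: "0 < a" "a \<le> 4 * B"
  shows "measure (\<Pi>\<^sub>M i\<in>I. M) {S \<in> space (\<Pi>\<^sub>M i\<in>I. M). real (card I) * a \<le> (\<Sum>i\<in>I. X (S i))}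
    \<le> exp (- (real (card I) * a\<^sup>2 / (16 * B)))"
proof -
  \<comment> \<open>This minimises 4 s^2 B - s a, with value -a^2 / (16 B); the premise
    \<open>a \<le> 4 * B\<close> is exactly s \<le> 1/2.\<close>
  define s where "s = a / (8 * B)"
  have s: "0 \<le> s" "s \<le> 1 / 2" using a by (auto simp: s_def field_simps)
  note mgf = mgf_le[OF X EX B s]
  interpret product_prob_space "\<lambda>_. M" I by standard
  let ?P = "\<Pi>\<^sub>M i\<in>I. M" and ?n = "real (card I)"
  let ?E = "{S \<in> space ?P. ?n * a \<le> (\<Sum>i\<in>I. X (S i))}"
  have [measurable]: "(\<lambda>S. X (S i)) \<in> borel_measurable ?P" if "i \<in> I" for i
    using that by measurable
  have E: "?E \<in> sets ?P" by measurable
  have "emeasure ?P ?E = (\<integral>\<^sup>+S. indicator ?E S \<partial>?P)" using E by simp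
  \<comment> \<open>Exponential Markov bound, written as a product so that the integral factors over
    the independent coordinates.\<close>
  also have "\<dots> \<le> (\<integral>\<^sup>+S. ennreal (exp (- (s * ?n * a))) * (\<Prod>i\<in>I. ennreal (exp (s * X (S i)))) \<partial>?P)"
  proof (intro nn_integral_mono)
    fix S assume "S \<in> space ?P"
    have "ennreal (exp (- (s * ?n * a))) * (\<Prod>i\<in>I. ennreal (exp (s * X (S i)))) =
        ennreal (exp (s * ((\<Sum>i\<in>I. X (S i)) - ?n * a)))"
      using I by (simp add: prod_ennreal exp_sum[symmetric] ennreal_mult[symmetric] exp_add[symmetric]
          sum_distrib_left[symmetric] algebra_simps)
    also have "\<dots> \<ge> indicator ?E S"
      using s by (auto simp: indicator_def)
    finally show "indicator ?E S \<le> ennreal (exp (- (s * ?n * a))) * (\<Prod>i\<in>I. ennreal (exp (s * X (S i))))" .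
  qed
  also have "\<dots> = ennreal (exp (- (s * ?n * a))) * (\<Prod>i\<in>I. (\<integral>\<^sup>+x. ennreal (exp (s * X x)) \<partial>M))"
    using I by (subst nn_integral_cmult, measurable) (subst product_nn_integral_prod, auto)
  also have "\<dots> \<le> ennreal (exp (- (s * ?n * a))) * (\<Prod>i\<in>I. ennreal (exp (4 * s\<^sup>2 * B)))"
    unfolding prod_constant by (intro mult_left_mono power_mono mgf) auto
  also have "\<dots> = ennreal (exp (?n * (4 * s\<^sup>2 * B - s * a)))"
    by (simp add: ennreal_power ennreal_mult[symmetric] exp_of_nat_mult[symmetric] exp_add[symmetric] algebra_simps)
  also have "?n * (4 * s\<^sup>2 * B - s * a) = - (?n * a\<^sup>2 / (16 * B))"
    using a by (simp add: s_def field_simps power2_eq_square)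
  finally show ?thesis
    by (simp add: measure_def enn2real_leI)
qed

section \<open>The logistic loss\<close>

lemma logistic_loss_deriv:
  "(logistic_loss has_real_derivative - (1 / (1 + exp z))) (at z)"
proof -
  have "1 + exp (- z) > 0" by (simp add: add_pos_pos)
  thus ?thesis
    unfolding logistic_loss_def[abs_def]
    by (auto intro!: derivative_eq_intros simp: exp_minus field_simps add_pos_pos)
qed

lemma logistic_loss_deriv2:
  "((\<lambda>z. - (1 / (1 + exp z))) has_real_derivative (exp z / (1 + exp z)\<^sup>2)) (at (z :: real))"
proof -
  have "1 + exp z > 0" by (simp add: add_pos_pos)
  thus ?thesis by (auto intro!: derivative_eq_intros simp: power2_eq_square)
qed

lemma logistic_loss_uminus: "logistic_loss (- z) = logistic_loss z + z"
proof -
  have "ln (1 + exp z) = ln (exp z * (1 + exp (- z)))"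
    by (simp add: distrib_left exp_add[symmetric] add.commute)
  also have "\<dots> = z + ln (1 + exp (- z))"
    by (subst ln_mult) (use add_pos_pos[of 1 "exp (- z)"] in auto)
  finally show ?thesis by (simp add: logistic_loss_def)
qed

lemma convex_on_logistic_loss: "convex_on UNIV logistic_loss"
  by (rule f''_ge0_imp_convex[OF _ logistic_loss_deriv logistic_loss_deriv2]) auto

text \<open>On [-B, B] the second derivative is at least exp (-B) / 4. Hence
  \<open>logistic_loss\<close> minus m z^2 with m = exp (-B) / 8 is convex there, and its tangent
  inequality at \<open>b\<close> rearranges to the claim.\<close>

lemma logistic_loss_lower_quadratic:
  assumes "\<bar>a\<bar> \<le> B" "\<bar>b\<bar> \<le> B"
  shows "logistic_loss b - (a - b) / (1 + exp b) + exp (- B) / 8 * (a - b)\<^sup>2 \<le> logistic_loss a"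
proof -
  define m where "m = exp (- B) / 8"
  have curv: "exp z / (1 + exp z)\<^sup>2 - 2 * m \<ge> 0" if "z \<in> {- B..B}" for z
  proof -
    have "exp z \<le> exp B" "exp (- z) \<le> exp B" "1 \<le> exp B" using that by auto
    moreover have "exp (- z) * (1 + exp z)\<^sup>2 = exp (- z) + 2 + exp z"
    proof -
      have e1: "exp z * exp (- z) = 1" by (simp add: exp_add[symmetric])
      have "exp (- z) * (1 + exp z)\<^sup>2 = exp (- z) + 2 * (exp z * exp (- z)) + (exp z * exp (- z)) * exp z"
        by (simp add: power2_eq_square algebra_simps)
      thus ?thesis by (simp add: e1)
    qed
    ultimately have "exp (- z) * (1 + exp z)\<^sup>2 \<le> 4 * exp B" by linarith
    hence "(1 + exp z)\<^sup>2 \<le> 4 * exp B * exp z"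
      by (simp add: exp_minus field_simps)
    hence "exp (- B) / 4 * (1 + exp z)\<^sup>2 \<le> exp (- B) / 4 * (4 * exp B * exp z)"
      by (intro mult_left_mono) auto
    also have "\<dots> = exp z" by (simp add: exp_minus)
    finally have "exp (- B) / 4 \<le> exp z / (1 + exp z)\<^sup>2"
      using add_pos_pos[of 1 "exp z"] by (subst pos_le_divide_eq) auto
    thus ?thesis by (simp add: m_def)
  qed
  have "(- (1 / (1 + exp b)) - 2 * m * b) * (a - b) \<le> (logistic_loss a - m * a\<^sup>2) - (logistic_loss b - m * b\<^sup>2)"
  proof (rule f''_imp_f'[of "{- B..B}"])
    show "((\<lambda>z. logistic_loss z - m * z\<^sup>2) has_real_derivative (- (1 / (1 + exp x)) - 2 * m * x)) (at x)" for x
      by (rule derivative_eq_intros logistic_loss_deriv refl | simp)+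
    show "((\<lambda>z. - (1 / (1 + exp z)) - 2 * m * z) has_real_derivative (exp x / (1 + exp x)\<^sup>2 - 2 * m)) (at x)" for x
      by (rule derivative_eq_intros logistic_loss_deriv2 refl | simp)+
  qed (use assms curv in auto)
  thus ?thesis by (simp add: m_def[symmetric] power2_eq_square algebra_simps)
qed

lemma logistic_loss_above_tangent: "logistic_loss b - (a - b) / (1 + exp b) \<le> logistic_loss a"
proof -
  have "0 \<le> exp (- max \<bar>a\<bar> \<bar>b\<bar>) / 8 * (a - b)\<^sup>2" by simp
  with logistic_loss_lower_quadratic[of a "max \<bar>a\<bar> \<bar>b\<bar>" b] show ?thesis by linarith
qed

text \<open>Strict convexity, from the quadratic bound at the midpoint towards \<open>a\<close> and
  towards \<open>b\<close>: the two tangent terms cancel and a positive square remains.\<close>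

lemma logistic_loss_midpoint_less:
  assumes "a \<noteq> b"
  shows "logistic_loss ((a + b) / 2) < (logistic_loss a + logistic_loss b) / 2"
proof -
  define c k B where "c = (a + b) / 2" "k = 1 / (1 + exp c)" "B = max \<bar>a\<bar> (max \<bar>b\<bar> \<bar>c\<bar>)"
  have "logistic_loss c - (a - c) * k + exp (- B) / 8 * (a - c)\<^sup>2 \<le> logistic_loss a"
    using logistic_loss_lower_quadratic[of a B c] by (simp add: c_k_B_def)
  moreover have "logistic_loss c - (b - c) * k + exp (- B) / 8 * (b - c)\<^sup>2 \<le> logistic_loss b"
    using logistic_loss_lower_quadratic[of b B c] by (simp add: c_k_B_def)
  moreover have "exp (- B) / 8 * (a - c)\<^sup>2 > 0"
    using assms by (simp add: c_k_B_def field_simps)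
  moreover have "exp (- B) / 8 * (b - c)\<^sup>2 \<ge> 0" by simp
  moreover have "(a - c) * k + (b - c) * k = 0"
    by (simp only: distrib_right[symmetric]) (simp add: c_k_B_def(1) field_simps)
  moreover have "2 * L < la + lb"
    if "L - T + P \<le> la" "L - U + Q \<le> lb" "P > 0" "Q \<ge> 0" "T + U = 0" for L T P la U Q lb :: real
    using that by linarith
  ultimately have "2 * logistic_loss c < logistic_loss a + logistic_loss b" by blast
  thus ?thesis by (simp add: c_k_B_def)
qed

lemma erm_loss_eq_tilted:
  "erm_loss n S w = (1 / real n) * (\<Sum>i=1..n. logistic_loss (w \<bullet> fst (S i)) + (1 - real (snd (S i))) * (w \<bullet> fst (S i)))"
  unfolding erm_loss_def
  by (intro arg_cong2[where f="(*)"] sum.cong refl)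
    (auto simp: logistic_loss_uminus algebra_simps split: prod.split)

text \<open>Since \<open>l (-z) = l z + z\<close>, convexity holds for every label in \<open>nat\<close>, not only for 0 and 1;
  this makes the measurability argument insensitive to the junk labels of the sample space.\<close>

lemma convex_on_erm_loss: "convex_on UNIV (erm_loss n S)"
proof -
  have 1: "convex_on UNIV (\<lambda>w. logistic_loss (w \<bullet> x) + c * (w \<bullet> x))" for x :: "real ^ 'n" and c :: real
  proof (rule convex_onI)
    fix t :: real and u v :: "real ^ 'n" assume t: "0 < t" "t < 1"
    have "logistic_loss ((1 - t) * (u \<bullet> x) + t * (v \<bullet> x)) \<le> (1 - t) * logistic_loss (u \<bullet> x) + t * logistic_loss (v \<bullet> x)"
      using convex_onD[OF convex_on_logistic_loss, of t "u \<bullet> x" "v \<bullet> x"] t by simp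
    thus "logistic_loss (((1 - t) *\<^sub>R u + t *\<^sub>R v) \<bullet> x) + c * (((1 - t) *\<^sub>R u + t *\<^sub>R v) \<bullet> x)
        \<le> (1 - t) * (logistic_loss (u \<bullet> x) + c * (u \<bullet> x)) + t * (logistic_loss (v \<bullet> x) + c * (v \<bullet> x))"
      by (simp add: inner_left_distrib algebra_simps)
  qed simp
  have 2: "convex_on UNIV (\<lambda>w. \<Sum>i\<in>A. f i w)" if "finite A" "\<And>i. convex_on UNIV (f i)"
    for f :: "nat \<Rightarrow> real ^ 'n \<Rightarrow> real" and A
    using that by (induction A) (simp_all add: convex_on_const convex_on_add)
  show ?thesis
    unfolding erm_loss_eq_tilted by (intro convex_on_cmul 2 1) auto
qed

section \<open>Consequences of convexity for the location of minimizers\<close>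

text \<open>The segment from \<open>v\<close> to \<open>w\<close> meets the sphere at
  \<open>p\<close>. Convexity along it gives c \<le> t (f w - f v) with t \<le> 1, so the gap can
  only grow beyond the sphere.\<close>

lemma convex_on_ge_outside_sphere:
  fixes f :: "'a :: real_normed_vector \<Rightarrow> real"
  assumes "convex_on UNIV f" "0 < r" "0 \<le> c" and sph: "\<And>w. dist w v = r \<Longrightarrow> f v + c \<le> f w"
    and w: "r \<le> dist w v"
  shows "f v + c \<le> f w"
proof -
  define t where "t = r / dist w v"
  have "0 < dist w v" using assms(2) w by linarith
  hence t: "0 < t" "t \<le> 1" using assms(2) w by (simp_all add: t_def)
  define p where "p = (1 - t) *\<^sub>R v + t *\<^sub>R w"
  have "p - v = t *\<^sub>R (w - v)" by (simp add: p_def algebra_simps)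
  hence "dist p v = r" using assms(2) \<open>0 < dist w v\<close> by (simp add: dist_norm t_def)
  from sph[OF this] have "f v + c \<le> (1 - t) * f v + t * f w"
    using convex_onD[OF assms(1), of t v w] t by (simp add: p_def)
  hence c: "c \<le> t * (f w - f v)" by (simp add: algebra_simps)
  hence "0 \<le> f w - f v" using t assms(3) by (metis order_trans zero_le_mult_iff not_le)
  hence "t * (f w - f v) \<le> f w - f v" using t by (simp add: mult_left_le_one_le)
  with c show ?thesis by simp
qed

lemma ex_minimizer_in_cball:
  fixes f :: "'a :: euclidean_space \<Rightarrow> real"
  assumes "continuous_on UNIV f" "0 < r" and out: "\<And>w. r \<le> dist w v \<Longrightarrow> f v \<le> f w"
  shows "\<exists>u. \<forall>w. f u \<le> f w"
proof -
  obtain u where u: "u \<in> cball v r" "\<And>w. w \<in> cball v r \<Longrightarrow> f u \<le> f w"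
    using continuous_attains_inf[of "cball v r" f] continuous_on_subset[OF assms(1)] assms(2) by auto
  have "f u \<le> f w" for w
  proof (cases "dist w v \<le> r")
    case False
    hence "f v \<le> f w" using out by simp
    thus ?thesis using u(2)[of v] assms(2) by simp
  qed (use u(2) in \<open>simp add: dist_commute\<close>)
  thus ?thesis by blast
qed

lemma is_arg_min_True_iff: "is_arg_min f (\<lambda>_. True) u \<longleftrightarrow> (\<forall>w. f u \<le> f w)" for f :: "_ \<Rightarrow> real"
  by (auto simp: is_arg_min_def not_less)

section \<open>Measurability of minimizers\<close>

text \<open>For a convex function, \<open>f q < inf f\<close> outside the ball of radius \<open>1 / k\<close> around \<open>q\<close>
  localises all minimizers in that ball. Quantifying \<open>q\<close> over a countable dense set and letting
  \<open>k\<close> tend to infinity expresses existence, uniqueness and location of the minimizer by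
  countably many evaluations of \<open>f\<close>.\<close>

lemma unique_minimizer_in_closed_iff:
  fixes f :: "'a :: euclidean_space \<Rightarrow> real" and e :: "nat \<Rightarrow> 'a"
  assumes cvx: "convex_on UNIV f" and K: "closed K" "K \<noteq> {}"
    and dense: "\<And>X. open X \<Longrightarrow> X \<noteq> {} \<Longrightarrow> \<exists>i. e i \<in> X"
  shows "(\<exists>w. unique_minimizer f w \<and> w \<noteq> 0 \<and> w \<in> K) \<longleftrightarrow>
    (\<forall>k. \<exists>i m. infdist (e i) K \<le> 1 / Suc k \<and>
       (\<forall>j. 1 / Suc k \<le> dist (e j) (e i) \<longrightarrow> f (e i) + 1 / Suc m \<le> f (e j))) \<and>
    (\<exists>j. f (e j) < f 0)" (is "?L \<longleftrightarrow> ?A \<and> ?B")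
proof
  have cont: "continuous_on UNIV f" using cvx by (intro convex_on_continuous) auto
  have opn: "open {x. f x < c}" for c using cont by (intro open_Collect_less) auto
  {
    assume ?L
    then obtain w where w: "\<And>z. f w \<le> f z" "\<And>v. (\<And>z. f v \<le> f z) \<Longrightarrow> v = w" "w \<noteq> 0" "w \<in> K"
      unfolding unique_minimizer_def is_arg_min_True_iff by blast
    hence lt: "f w < f z" if "z \<noteq> w" for z
      using that by (metis dual_order.trans not_le)
    have ?A
    proof
      fix k
      define r where "r = 1 / real (Suc k)"
      have r: "r > 0" by (simp add: r_def)
      \<comment> \<open>The gap is attained on the compact sphere, and it is positive because
        \<open>w\<close> is the strict minimizer.\<close>
      obtain c where c: "c > 0" "\<And>z. dist z w = r / 2 \<Longrightarrow> f w + c \<le> f z"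
      proof (cases "sphere w (r / 2) = {}")
        case True
        thus ?thesis using r by simp
      next
        case False
        then obtain z where z: "z \<in> sphere w (r / 2)" "\<And>y. y \<in> sphere w (r / 2) \<Longrightarrow> f z \<le> f y"
          using continuous_attains_inf[of "sphere w (r / 2)" f] continuous_on_subset[OF cont] by auto
        have "z \<noteq> w" using z(1) r by auto
        thus ?thesis using that[of "f z - f w"] lt[of z] z(2) by (auto simp: dist_commute)
      qed
      have out: "f w + c \<le> f z" if "r / 2 \<le> dist z w" for z
        using convex_on_ge_outside_sphere[OF cvx _ _ c(2) that] c(1) r by simp
      \<comment> \<open>Replacing \<open>w\<close> by a dense point costs r / 2 in distance and c /
        2 in value; this is why the gap was taken at radius r / 2, and it leaves room for 1 / Suc m
        below c / 2.\<close>
      define N where "N = ball w (r / 2) \<inter> {x. f x < f w + c / 2}"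
      have "open N" unfolding N_def by (intro open_Int opn) auto
      moreover have "w \<in> N" using r c by (simp add: N_def)
      ultimately obtain i where "e i \<in> N" using dense[of N] by blast
      hence i: "dist w (e i) < r / 2" "f (e i) < f w + c / 2" by (auto simp: N_def)
      obtain m where m: "1 / real (Suc m) < c / 2"
        using c(1) by (metis half_gt_zero nat_approx_posE)
      have "infdist (e i) K \<le> r"
        using infdist_le[OF w(4), of "e i"] i r by (simp add: dist_commute)
      moreover have "f (e i) + 1 / Suc m \<le> f (e j)" if "r \<le> dist (e j) (e i)" for j
      proof -
        have "r / 2 \<le> dist (e j) w"
          using that i dist_triangle[of "e j" "e i" w] by simp
        from out[OF this] show ?thesis using i m by linarith
      qed
      ultimately show "\<exists>i m. infdist (e i) K \<le> 1 / Suc k \<and>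
         (\<forall>j. 1 / Suc k \<le> dist (e j) (e i) \<longrightarrow> f (e i) + 1 / Suc m \<le> f (e j))"
        unfolding r_def by blast
    qed
    \<comment> \<open>The condition \<open>w \<noteq> 0\<close>: since 0 is not the minimizer, the
      open set where \<open>f\<close> is below \<open>f 0\<close> is nonempty and contains a dense
      point.\<close>
    moreover have ?B
      using dense[OF opn[of "f 0"]] lt[of 0] w(3) by auto
    ultimately show "?A \<and> ?B" ..
  }
  assume AB: "?A \<and> ?B"
  then obtain i m where im: "\<And>k. infdist (e (i k)) K \<le> 1 / Suc k"
    "\<And>k j. 1 / Suc k \<le> dist (e j) (e (i k)) \<Longrightarrow> f (e (i k)) + 1 / Suc (m k) \<le> f (e j)"
    by metis
  \<comment> \<open>Extends the gap from dense points to all points; the distance inequality is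
    strict so that a counterexample would fill an open set.\<close>
  have out: "f (e (i k)) + 1 / Suc (m k) \<le> f z" if "1 / Suc k < dist z (e (i k))" for k z
  proof (rule ccontr)
    assume neg: "\<not> ?thesis"
    define N where "N = {z. 1 / Suc k < dist z (e (i k))} \<inter> {x. f x < f (e (i k)) + 1 / Suc (m k)}"
    have "open N"
      unfolding N_def by (intro open_Int opn open_Collect_less continuous_intros)
    moreover have "z \<in> N" using that neg by (simp add: N_def)
    ultimately obtain j where "e j \<in> N" using dense[of N] by blast
    hence "1 / Suc k < dist (e j) (e (i k))" "f (e j) < f (e (i k)) + 1 / Suc (m k)" by (auto simp: N_def)
    thus False using im(2)[of k j] by simp
  qed
  have near: "dist u (e (i k)) \<le> 1 / Suc k" if "\<And>z. f u \<le> f z" for u k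
  proof (rule ccontr)
    assume "\<not> ?thesis"
    hence "f (e (i k)) + 1 / Suc (m k) \<le> f u" by (intro out) simp
    moreover have "(0 :: real) < 1 / Suc (m k)" by simp
    ultimately show False using that[of "e (i k)"] by linarith
  qed
  have "\<exists>u. \<forall>w. f u \<le> f w"
  \<comment> \<open>For k = 0 the gap holds beyond distance 1, so radius 2 satisfies the strict
    inequality in \<open>out\<close>.\<close>
  proof (rule ex_minimizer_in_cball[OF cont, of 2 "e (i 0)"])
    fix w assume "2 \<le> dist w (e (i 0))"
    hence "f (e (i 0)) + 1 / Suc (m 0) \<le> f w" by (intro out) simp
    moreover have "(0 :: real) < 1 / Suc (m 0)" by simp
    ultimately show "f (e (i 0)) \<le> f w" by linarith
  qed simp
  then obtain u where u: "\<And>w. f u \<le> f w" by blast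
  have small: "x = 0" if "0 \<le> x" "\<And>k. x \<le> 2 / Suc k" for x :: real
  proof (rule ccontr)
    assume "x \<noteq> 0"
    hence "x / 2 > 0" using that(1) by simp
    then obtain k where "1 / real (Suc k) < x / 2" by (rule nat_approx_posE)
    moreover have "2 / real (Suc k) = 2 * (1 / real (Suc k))" by simp
    ultimately show False using that(2)[of k] by linarith
  qed
  have "v = u" if "\<And>w. f v \<le> f w" for v
  proof -
    have "dist v u \<le> 2 / Suc k" for k
      using near[OF that, of k] near[OF u, of k] dist_triangle2[of v u "e (i k)"] by simp
    thus ?thesis using small[of "dist v u"] by simp
  qed
  moreover have "u \<in> K"
  proof -
    have "infdist u K \<le> 2 / Suc k" for k
      using near[OF u, of k] im(1)[of k] infdist_triangle[of u K "e (i k)"] by simp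
    hence "infdist u K = 0" by (intro small infdist_nonneg)
    thus ?thesis using K by (simp add: in_closed_iff_infdist_zero)
  qed
  moreover have "u \<noteq> 0" using AB u by (metis not_le)
  ultimately show ?L
    using u unfolding unique_minimizer_def is_arg_min_True_iff by blast
qed

lemma sets_unique_minimizer_in_closed:
  fixes f :: "'s \<Rightarrow> 'a :: euclidean_space \<Rightarrow> real"
  assumes cvx: "\<And>S. S \<in> space M \<Longrightarrow> convex_on UNIV (f S)" and K: "closed K" "K \<noteq> {}"
    and [measurable]: "\<And>w. (\<lambda>S. f S w) \<in> borel_measurable M"
  shows "{S \<in> space M. \<exists>w. unique_minimizer (f S) w \<and> w \<noteq> 0 \<and> w \<in> K} \<in> sets M"
proof -
  obtain D :: "'a set" where D: "countable D" "\<And>X. open X \<Longrightarrow> X \<noteq> {} \<Longrightarrow> \<exists>d\<in>D. d \<in> X"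
    using countable_dense_setE by blast
  have "D \<noteq> {}" using D(2)[of UNIV] by auto
  define e where "e = from_nat_into D"
  have dense: "\<exists>i. e i \<in> X" if "open X" "X \<noteq> {}" for X
    using D(2)[OF that] range_from_nat_into[OF \<open>D \<noteq> {}\<close> D(1)] unfolding e_def by (metis imageE)
  have "{S \<in> space M. \<exists>w. unique_minimizer (f S) w \<and> w \<noteq> 0 \<and> w \<in> K} =
    {S \<in> space M. (\<forall>k. \<exists>i m. infdist (e i) K \<le> 1 / Suc k \<and>
       (\<forall>j. 1 / Suc k \<le> dist (e j) (e i) \<longrightarrow> f S (e i) + 1 / Suc m \<le> f S (e j))) \<and>
    (\<exists>j. f S (e j) < f S 0)}"
    by (intro Collect_cong conj_cong refl unique_minimizer_in_closed_iff cvx K dense)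
  also have "\<dots> \<in> sets M" by measurable
  finally show ?thesis .
qed

section \<open>Deterministic localisation of the minimizer\<close>

text \<open>As |h| is at most the sum of the |h_j|, some coordinate is at least |h| / d in absolute
  value. Moving \<open>z\<close> off \<open>axis j 1\<close> by less than 1 / (2 d) changes the
  inner product by at most half of that.\<close>

lemma ex_coordinate_ball_inner_ge:
  fixes h :: "real ^ 'n"
  shows "\<exists>j. \<forall>z\<in>ball (axis j 1) (1 / (2 * real CARD('n))). norm h / (2 * real CARD('n)) \<le> \<bar>h \<bullet> z\<bar>"
proof -
  let ?d = "real CARD('n)"
  have d: "?d > 0" by simp
  have "\<exists>j. norm h / ?d \<le> \<bar>h $ j\<bar>"
  proof (rule ccontr)
    assume "\<not> ?thesis"
    hence "(\<Sum>j\<in>UNIV. \<bar>h $ j\<bar>) < (\<Sum>j\<in>(UNIV :: 'n set). norm h / ?d)"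
      by (intro sum_strict_mono) (auto simp: not_le)
    thus False using norm_le_l1_cart[of h] by simp
  qed
  then obtain j where j: "norm h / ?d \<le> \<bar>h $ j\<bar>" ..
  have "norm h / (2 * ?d) \<le> \<bar>h \<bullet> z\<bar>" if "z \<in> ball (axis j 1) (1 / (2 * ?d))" for z
  proof -
    have "\<bar>h \<bullet> (z - axis j 1)\<bar> \<le> norm h * (1 / (2 * ?d))"
      using that by (intro order_trans[OF Cauchy_Schwarz_ineq2] mult_left_mono)
        (auto simp: dist_norm norm_minus_commute)
    moreover have "h \<bullet> z = h $ j + h \<bullet> (z - axis j 1)"
      by (simp add: inner_diff_right inner_axis)
    moreover have "norm h / ?d = 2 * (norm h / (2 * ?d))" by simp
    moreover have "norm h * (1 / (2 * ?d)) = norm h / (2 * ?d)" by simp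
    ultimately show ?thesis using j by linarith
  qed
  thus ?thesis by blast
qed

lemma erm_loss_signed_feature:
  assumes "\<And>i. i \<in> {1..n} \<Longrightarrow> snd (S i) = 0 \<or> snd (S i) = 1"
  shows "erm_loss n S w = (1 / real n) * (\<Sum>i=1..n. logistic_loss (w \<bullet> signed_feature (S i)))"
  unfolding erm_loss_def
proof (intro arg_cong2[where f="(*)"] sum.cong refl)
  fix i assume "i \<in> {1..n}"
  from assms[OF this] show "(case S i of (x, y) \<Rightarrow> real y * logistic_loss (w \<bullet> x) + (1 - real y) * logistic_loss (- (w \<bullet> x)))
    = logistic_loss (w \<bullet> signed_feature (S i))"
    by (auto simp: signed_feature_def split: prod.splits)
qed

text \<open>On the sphere the gradient term costs at most d r t per sample, and the samples near
  \<open>axis j 1\<close> gain at least m q (r / (2 d))^2 with m = exp (-4 |v|) / 8. The bound on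
  \<open>t\<close> says that the gain wins. The exponent is 4 |v| because |w| \<le> 2 |v| on the
  sphere and samples in the balls have norm at most 2.\<close>

lemma erm_minimizer_near:
  fixes S :: "nat \<Rightarrow> (real ^ 'n) \<times> nat" and v :: "real ^ 'n"
  defines "d \<equiv> real CARD('n)"
  assumes n: "n > 0" and labels: "\<And>i. i \<in> {1..n} \<Longrightarrow> snd (S i) = 0 \<or> snd (S i) = 1"
    and r: "0 < r" "r \<le> norm v" and q: "0 < q"
    and grad: "\<And>j. \<bar>\<Sum>i=1..n. signed_feature (S i) $ j / (1 + exp (v \<bullet> signed_feature (S i)))\<bar> \<le> real n * t"
    and freq: "\<And>j. real n * q \<le> real (card {i \<in> {1..n}. signed_feature (S i) \<in> ball (axis j 1) (1 / (2 * d))})"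
    and t: "t < exp (- (4 * norm v)) / 8 * q * r / (4 * d ^ 3)"
  shows "\<exists>w. unique_minimizer (erm_loss n S) w \<and> dist w v \<le> r"
proof -
  define z where "z i = signed_feature (S i)" for i
  define f where "f = erm_loss n S"
  have f: "f w = (1 / real n) * (\<Sum>i=1..n. logistic_loss (w \<bullet> z i))" for w
    unfolding f_def z_def by (rule erm_loss_signed_feature) (rule labels)
  have cvx: "convex_on UNIV f" unfolding f_def by (rule convex_on_erm_loss)
  have cont: "continuous_on UNIV f" using cvx by (intro convex_on_continuous) auto
  define m where "m = exp (- (4 * norm v)) / 8"
  have d: "d \<ge> 1" by (simp add: d_def)
  \<comment> \<open>The net gap on the sphere: quadratic gain minus gradient loss.\<close>
  define c where "c = r * (m * q * r / (4 * d\<^sup>2) - d * t)"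
  have "d * t < d * (m * q * r / (4 * d ^ 3))"
    using t d by (intro mult_strict_left_mono) (auto simp: m_def)
  also have "\<dots> = m * q * r / (4 * d\<^sup>2)"
    using d by (simp add: field_simps power2_eq_square power3_eq_cube)
  finally have c: "c > 0" using r by (simp add: c_def)
  have sph: "f v + c \<le> f w" if "dist w v = r" for w
  proof -
    define h where "h = w - v"
    have nh: "norm h = r" using that by (simp add: h_def dist_norm)
    obtain j where j: "\<And>x. x \<in> ball (axis j 1) (1 / (2 * d)) \<Longrightarrow> norm h / (2 * d) \<le> \<bar>h \<bullet> x\<bar>"
      using ex_coordinate_ball_inner_ge[of h] unfolding d_def by blast
    let ?B = "ball (axis j 1 :: real ^ 'n) (1 / (2 * d))"
    have point: "logistic_loss (v \<bullet> z i) - h \<bullet> ((1 / (1 + exp (v \<bullet> z i))) *\<^sub>R z i) + m * (r / (2 * d))\<^sup>2 * (if z i \<in> ?B then 1 else 0)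
        \<le> logistic_loss (w \<bullet> z i)" for i
    proof (cases "z i \<in> ?B")
      case False
      thus ?thesis using logistic_loss_above_tangent[of "v \<bullet> z i" "w \<bullet> z i"]
        by (simp add: h_def inner_diff_left)
    next
      case True
      have "norm (z i) \<le> norm (axis j 1 :: real ^ 'n) + dist (axis j 1) (z i)"
        by (metis dist_commute dist_norm norm_triangle_sub)
      also have "\<dots> \<le> 1 + 1 / (2 * d)" using True by (simp add: less_imp_le)
      also have "\<dots> \<le> 2" using d by (simp add: field_simps)
      finally have nz: "norm (z i) \<le> 2" .
      have "norm w \<le> norm v + norm h" using norm_triangle_ineq[of v h] by (simp add: h_def)
      hence "norm w \<le> 2 * norm v" using nh r by simp
      hence "norm w * norm (z i) \<le> 2 * norm v * 2" by (intro mult_mono nz) auto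
      hence aB: "\<bar>w \<bullet> z i\<bar> \<le> 4 * norm v" using Cauchy_Schwarz_ineq2[of w "z i"] by linarith
      have "norm v * norm (z i) \<le> norm v * 2" by (intro mult_left_mono nz) auto
      hence bB: "\<bar>v \<bullet> z i\<bar> \<le> 4 * norm v" using Cauchy_Schwarz_ineq2[of v "z i"] norm_ge_zero[of v] by linarith
      have "(r / (2 * d))\<^sup>2 \<le> \<bar>h \<bullet> z i\<bar>\<^sup>2"
        using j[OF True] r d nh by (intro power_mono) auto
      hence "m * (r / (2 * d))\<^sup>2 \<le> m * (w \<bullet> z i - v \<bullet> z i)\<^sup>2"
        by (intro mult_left_mono) (auto simp: m_def h_def inner_diff_left)
      moreover have "logistic_loss (v \<bullet> z i) - (w \<bullet> z i - v \<bullet> z i) / (1 + exp (v \<bullet> z i)) + m * (w \<bullet> z i - v \<bullet> z i)\<^sup>2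
          \<le> logistic_loss (w \<bullet> z i)"
        unfolding m_def by (rule logistic_loss_lower_quadratic[OF aB bB])
      moreover have "h \<bullet> ((1 / (1 + exp (v \<bullet> z i))) *\<^sub>R z i) = (w \<bullet> z i - v \<bullet> z i) / (1 + exp (v \<bullet> z i))"
        by (simp add: h_def inner_diff_left)
      moreover have "m * (r / (2 * d))\<^sup>2 * (if z i \<in> ?B then 1 else 0) = m * (r / (2 * d))\<^sup>2"
        using True by simp
      ultimately show ?thesis by linarith
    qed
    define G where "G = (\<Sum>i=1..n. (1 / (1 + exp (v \<bullet> z i))) *\<^sub>R z i)"
    define N where "N = real (card {i \<in> {1..n}. z i \<in> ?B})"
    have "(\<Sum>i=1..n. logistic_loss (v \<bullet> z i)) - h \<bullet> G + m * (r / (2 * d))\<^sup>2 * N \<le> (\<Sum>i=1..n. logistic_loss (w \<bullet> z i))"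
    proof -
      have N: "(\<Sum>i=1..n. if z i \<in> ?B then 1 else 0) = N"
        by (simp add: N_def sum.If_cases Int_def)
      have "(\<Sum>i=1..n. logistic_loss (v \<bullet> z i)) - h \<bullet> G + m * (r / (2 * d))\<^sup>2 * N =
         (\<Sum>i=1..n. logistic_loss (v \<bullet> z i) - h \<bullet> ((1 / (1 + exp (v \<bullet> z i))) *\<^sub>R z i) + m * (r / (2 * d))\<^sup>2 * (if z i \<in> ?B then 1 else 0))"
        unfolding N[symmetric] G_def sum.distrib sum_subtractf sum_distrib_left inner_sum_right ..
      also have "\<dots> \<le> (\<Sum>i=1..n. logistic_loss (w \<bullet> z i))" by (intro sum_mono point)
      finally show ?thesis .
    qed
    moreover have "h \<bullet> G \<le> d * (r * (real n * t))"
    proof -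
      have "h \<bullet> G = (\<Sum>j\<in>UNIV. h $ j * G $ j)" by (simp add: inner_vec_def)
      also have "\<dots> \<le> (\<Sum>j\<in>(UNIV :: 'n set). r * (real n * t))"
      proof (intro sum_mono)
        fix j
        have "G $ j = (\<Sum>i=1..n. z i $ j / (1 + exp (v \<bullet> z i)))" by (simp add: G_def sum_component)
        hence "\<bar>G $ j\<bar> \<le> real n * t" using grad[of j] by (simp add: z_def)
        moreover have "\<bar>h $ j\<bar> \<le> r" using component_le_norm_cart[of h j] nh by simp
        ultimately have "\<bar>h $ j\<bar> * \<bar>G $ j\<bar> \<le> r * (real n * t)" using r by (intro mult_mono) auto
        thus "h $ j * G $ j \<le> r * (real n * t)" by (metis abs_le_D1 abs_mult)
      qed
      finally show ?thesis by (simp add: d_def)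
    qed
    moreover have "m * (r / (2 * d))\<^sup>2 * (real n * q) \<le> m * (r / (2 * d))\<^sup>2 * N"
      using freq[of j] by (intro mult_left_mono) (auto simp: N_def z_def m_def)
    moreover have "m * (r / (2 * d))\<^sup>2 * (real n * q) - d * (r * (real n * t)) = real n * c"
      using d by (simp add: c_def field_simps power2_eq_square)
    ultimately have "(\<Sum>i=1..n. logistic_loss (v \<bullet> z i)) + real n * c \<le> (\<Sum>i=1..n. logistic_loss (w \<bullet> z i))"
      by linarith
    hence "(1 / real n) * ((\<Sum>i=1..n. logistic_loss (v \<bullet> z i)) + real n * c) \<le> (1 / real n) * (\<Sum>i=1..n. logistic_loss (w \<bullet> z i))"
      by (intro mult_left_mono) auto
    thus ?thesis using n by (simp add: f distrib_left)
  qed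
  have out: "f v + c \<le> f w" if "r \<le> dist w v" for w
    using convex_on_ge_outside_sphere[OF cvx r(1) _ sph that] c by simp
  have "\<exists>u. \<forall>w. f u \<le> f w"
    using out c by (intro ex_minimizer_in_cball[OF cont r(1), of v]) (smt (verit))
  then obtain u where u: "\<And>w. f u \<le> f w" by blast
  have "dist u v \<le> r" using out[of u] u[of v] c by linarith
  \<comment> \<open>If two minimizers differed, some sample in the ball chosen for their difference
    would separate them, and strict convexity at that sample would make the midpoint better than
    both.\<close>
  moreover have "x = u" if x: "\<And>w. f x \<le> f w" for x
  proof (rule ccontr)
    assume "x \<noteq> u"
    define h where "h = x - u"
    have nh: "norm h > 0" using \<open>x \<noteq> u\<close> by (simp add: h_def)
    obtain j where j: "\<And>x. x \<in> ball (axis j 1) (1 / (2 * d)) \<Longrightarrow> norm h / (2 * d) \<le> \<bar>h \<bullet> x\<bar>"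
      using ex_coordinate_ball_inner_ge[of h] unfolding d_def by blast
    have "0 < real n * q" using n q by simp
    also have "\<dots> \<le> real (card {i \<in> {1..n}. z i \<in> ball (axis j 1) (1 / (2 * d))})"
      using freq[of j] unfolding z_def .
    finally have "{i \<in> {1..n}. z i \<in> ball (axis j 1) (1 / (2 * d))} \<noteq> {}" by (metis card.empty less_irrefl of_nat_0)
    then obtain k where k: "k \<in> {1..n}" "z k \<in> ball (axis j 1) (1 / (2 * d))" by blast
    have "norm h / (2 * d) > 0" using nh d by simp
    hence ne: "x \<bullet> z k \<noteq> u \<bullet> z k" using j[OF k(2)] by (auto simp: h_def inner_diff_left)
    define p where "p = (1 / 2) *\<^sub>R (x + u)"
    have pi: "p \<bullet> z i = (x \<bullet> z i + u \<bullet> z i) / 2" for i by (simp add: p_def inner_add_left)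
    have "(\<Sum>i=1..n. logistic_loss (p \<bullet> z i)) < (\<Sum>i=1..n. (logistic_loss (x \<bullet> z i) + logistic_loss (u \<bullet> z i)) / 2)"
    proof (rule sum_strict_mono_ex1)
      show "\<forall>i\<in>{1..n}. logistic_loss (p \<bullet> z i) \<le> (logistic_loss (x \<bullet> z i) + logistic_loss (u \<bullet> z i)) / 2"
      proof
        fix i show "logistic_loss (p \<bullet> z i) \<le> (logistic_loss (x \<bullet> z i) + logistic_loss (u \<bullet> z i)) / 2"
          using logistic_loss_midpoint_less[of "x \<bullet> z i" "u \<bullet> z i"]
          by (cases "x \<bullet> z i = u \<bullet> z i") (auto simp: pi)
      qed
      show "\<exists>i\<in>{1..n}. logistic_loss (p \<bullet> z i) < (logistic_loss (x \<bullet> z i) + logistic_loss (u \<bullet> z i)) / 2"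
        using logistic_loss_midpoint_less[OF ne] k(1) by (auto simp: pi)
    qed simp
    hence "f p < (1 / real n) * (\<Sum>i=1..n. (logistic_loss (x \<bullet> z i) + logistic_loss (u \<bullet> z i)) / 2)"
      unfolding f using n by (intro mult_strict_left_mono) auto
    also have "\<dots> = (f x + f u) / 2"
      by (simp add: f sum_divide_distrib[symmetric] sum.distrib distrib_left add_divide_distrib)
    finally show False using x[of p] u[of p] by simp
  qed
  ultimately show ?thesis
    using u unfolding unique_minimizer_def is_arg_min_True_iff f_def[symmetric] by blast
qed

text \<open>Here |u| \<le> (1 + \<epsilon>/2) |v| and u . v \<ge> (1 - \<epsilon>/2) |v|^2. The
  radius \<epsilon> |v| / 2 works because (1 - \<epsilon>)(1 + \<epsilon>/2) \<le> 1 -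
  \<epsilon>/2.\<close>

lemma cos_sim_ge_of_dist:
  fixes u v :: "real ^ 'n"
  assumes "v \<noteq> 0" "0 < \<epsilon>" "\<epsilon> < 1" "dist u v \<le> \<epsilon> / 2 * norm v"
  shows "u \<noteq> 0" "cos_sim u v \<ge> 1 - \<epsilon>"
proof -
  have nv: "norm v > 0" using assms by simp
  have "\<epsilon> / 2 * norm v < 1 * norm v" using assms nv by (intro mult_strict_right_mono) auto
  hence "dist u v < norm v" using assms(4) by linarith
  thus u0: "u \<noteq> 0" by auto
  have "norm u \<le> norm v + dist u v" by (metis dist_norm norm_triangle_sub)
  hence nu: "norm u \<le> (1 + \<epsilon> / 2) * norm v" using assms by (simp add: algebra_simps)
  have "\<bar>(u - v) \<bullet> v\<bar> \<le> \<epsilon> / 2 * norm v * norm v"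
    using assms(4) by (intro order_trans[OF Cauchy_Schwarz_ineq2] mult_right_mono) (auto simp: dist_norm)
  moreover have "u \<bullet> v = (u - v) \<bullet> v + norm v * norm v"
    by (simp add: inner_diff_left dot_square_norm power2_eq_square)
  ultimately have "norm v * norm v - \<epsilon> / 2 * norm v * norm v \<le> u \<bullet> v" by linarith
  hence uv: "(1 - \<epsilon> / 2) * (norm v * norm v) \<le> u \<bullet> v" by (simp add: left_diff_distrib mult.assoc)
  have "(1 - \<epsilon>) * (norm u * norm v) \<le> (1 - \<epsilon>) * ((1 + \<epsilon> / 2) * norm v * norm v)"
    using assms nu by (intro mult_left_mono mult_right_mono) auto
  also have "\<dots> = ((1 - \<epsilon>) * (1 + \<epsilon> / 2)) * (norm v * norm v)" by simp
  also have "\<dots> \<le> (1 - \<epsilon> / 2) * (norm v * norm v)"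
    using assms by (intro mult_right_mono) (auto simp: algebra_simps)
  also note uv
  finally show "cos_sim u v \<ge> 1 - \<epsilon>"
    using u0 nv by (simp add: cos_sim_def field_simps)
qed

lemma cos_sim_scaleR_right: "c > 0 \<Longrightarrow> cos_sim u (c *\<^sub>R v) = cos_sim u v"
  by (simp add: cos_sim_def)

section \<open>Gaussian estimates\<close>

lemma det_scaleR: "det (c *\<^sub>R A) = c ^ CARD('n) * det A" for A :: "real ^ 'n ^ 'n"
proof -
  have "c *\<^sub>R A = (\<chi> i. c *s (A $ i))" by (simp add: vec_eq_iff)
  thus ?thesis by (simp add: det_rows_mul[of "\<lambda>_. c" "\<lambda>i. A $ i"])
qed

lemma mvn_density_scaled:
  fixes \<Sigma> :: "real ^ 'n ^ 'n"
  assumes "pos_def \<Sigma>" "\<kappa> > 0"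
  shows "mvn_density \<mu> ((1 / \<kappa>) *\<^sub>R \<Sigma>) x = sqrt (\<kappa> ^ CARD('n)) / sqrt ((2 * pi) ^ CARD('n) * det \<Sigma>) *
    exp (- (\<kappa> * ((x - \<mu>) \<bullet> (matrix_inv \<Sigma> *v (x - \<mu>))) / 2))"
proof -
  have "matrix_inv ((1 / \<kappa>) *\<^sub>R \<Sigma>) = \<kappa> *\<^sub>R matrix_inv \<Sigma>"
    using matrix_inv_scaleR[of "1 / \<kappa>" \<Sigma>] assms(2) pos_def_invertible[OF assms(1)] by simp
  moreover have "(2 * pi) ^ CARD('n) * det ((1 / \<kappa>) *\<^sub>R \<Sigma>) = ((2 * pi) ^ CARD('n) * det \<Sigma>) / \<kappa> ^ CARD('n)"
    by (simp add: det_scaleR power_one_over field_simps)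
  ultimately show ?thesis
    unfolding mvn_density_def
    by (simp add: scaleR_matrix_vector_assoc[symmetric] real_sqrt_divide)
qed

text \<open>The constant is the minimum of the form on the unit sphere, extended to all vectors by
  homogeneity.\<close>

lemma pos_def_coercive:
  fixes B :: "real ^ 'n ^ 'n"
  assumes "pos_def B"
  shows "\<exists>c>0. \<forall>x. c * (norm x)\<^sup>2 \<le> x \<bullet> (B *v x)"
proof -
  have "continuous_on (sphere 0 1) (\<lambda>x. x \<bullet> (B *v x))" by (intro continuous_intros)
  moreover have "sphere (0 :: real ^ 'n) 1 \<noteq> {}" by simp
  ultimately obtain e where e: "e \<in> sphere 0 1" "\<And>y. y \<in> sphere 0 1 \<Longrightarrow> e \<bullet> (B *v e) \<le> y \<bullet> (B *v y)"
    using continuous_attains_inf[of "sphere 0 1" "\<lambda>x. x \<bullet> (B *v x)"] by auto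
  have "e \<bullet> (B *v e) * (norm x)\<^sup>2 \<le> x \<bullet> (B *v x)" for x
  proof (cases "x = 0")
    case False
    define y where "y = (1 / norm x) *\<^sub>R x"
    have y: "x = norm x *\<^sub>R y" "y \<in> sphere 0 1" using False by (auto simp: y_def)
    have "x \<bullet> (B *v x) = (norm x)\<^sup>2 * (y \<bullet> (B *v y))"
      by (subst (1 2) y(1)) (simp add: matrix_vector_mult_scaleR power2_eq_square)
    thus ?thesis using mult_left_mono[OF e(2)[OF y(2)], of "(norm x)\<^sup>2"] by (simp add: mult.commute)
  qed simp
  moreover have "e \<noteq> 0" using e(1) by auto
  hence "e \<bullet> (B *v e) > 0" using assms by (simp add: pos_def_def)
  ultimately show ?thesis by blast
qed

text \<open>The norm is absorbed by half of the exponent: |z| is at most a constant plus Q z / 4,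
  whereas \<kappa> Q z / 2 is at least Q z / 2. What remains is a multiple of the Gaussian density
  for \<kappa> = 1/2, which integrates to 1.\<close>

lemma mvn_exp_norm_moment:
  fixes \<mu> :: "real ^ 'n"
  assumes \<Sigma>: "pos_def \<Sigma>"
  shows "\<exists>M\<ge>3. \<forall>\<kappa>\<ge>1. (\<integral>\<^sup>+z. ennreal (exp (norm z)) \<partial>mvn \<mu> ((1 / \<kappa>) *\<^sub>R \<Sigma>)) \<le> ennreal (\<kappa> ^ CARD('n) * M)"
proof -
  define Q where "Q z = (z - \<mu>) \<bullet> (matrix_inv \<Sigma> *v (z - \<mu>))" for z
  define N where "N = sqrt ((2 * pi) ^ CARD('n) * det \<Sigma>)"
  have N: "N > 0" using pos_def_det[OF \<Sigma>] by (simp add: N_def)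
  have dens: "mvn_density \<mu> ((1 / \<kappa>) *\<^sub>R \<Sigma>) z = sqrt (\<kappa> ^ CARD('n)) / N * exp (- (\<kappa> * Q z / 2))" if "\<kappa> > 0" for \<kappa> z
    unfolding Q_def N_def by (rule mvn_density_scaled[OF \<Sigma> that])
  obtain c where c: "c > 0" "\<And>x. c * (norm x)\<^sup>2 \<le> x \<bullet> (matrix_inv \<Sigma> *v x)"
    using pos_def_coercive[OF pos_def_matrix_inv[OF \<Sigma>]] by blast
  have Q: "norm z \<le> norm \<mu> + 1 / c + Q z / 4" for z
  proof -
    define y where "y = norm (z - \<mu>)"
    have "0 \<le> (c * y / 2 - 1)\<^sup>2" by simp
    hence "c * y \<le> 1 + c * (c * y\<^sup>2) / 4" by (simp add: power2_eq_square algebra_simps)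
    hence "y \<le> (1 + c * (c * y\<^sup>2) / 4) / c" using c(1) by (simp add: pos_le_divide_eq mult.commute)
    also have "\<dots> = 1 / c + c * y\<^sup>2 / 4" using c(1) by (simp add: field_simps)
    also have "c * y\<^sup>2 \<le> Q z" unfolding Q_def y_def by (rule c(2))
    finally have "y \<le> 1 / c + Q z / 4" by simp
    moreover have "norm z \<le> norm \<mu> + y" unfolding y_def using norm_triangle_sub[of z \<mu>] by simp
    ultimately show ?thesis by simp
  qed
  have Q0: "Q z \<ge> 0" for z
    using order_trans[OF _ c(2)[of "z - \<mu>"]] c(1) by (simp add: Q_def)
  \<comment> \<open>The denominator cancels the prefactor of the comparison density at \<kappa> =
    1/2.\<close>
  define M0 where "M0 = exp (norm \<mu> + 1 / c) / sqrt ((1 / 2) ^ CARD('n))"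
  have M0: "M0 > 0" by (simp add: M0_def)
  have bd: "exp (norm z) * mvn_density \<mu> ((1 / \<kappa>) *\<^sub>R \<Sigma>) z \<le> \<kappa> ^ CARD('n) * M0 * mvn_density \<mu> ((1 / (1 / 2)) *\<^sub>R \<Sigma>) z"
    if "\<kappa> \<ge> 1" for \<kappa> z
  proof -
    have "sqrt (\<kappa> ^ CARD('n)) \<le> \<kappa> ^ CARD('n)"
      using one_le_power[OF that, of "CARD('n)"] by (intro real_le_lsqrt) (auto simp: power2_eq_square)
    moreover have "exp (norm z) * exp (- (\<kappa> * Q z / 2)) \<le> exp (norm \<mu> + 1 / c) * exp (- (Q z / 4))"
    proof -
      have "Q z \<le> \<kappa> * Q z" using mult_right_mono[OF that Q0[of z]] by simp
      hence "norm z + - (\<kappa> * Q z / 2) \<le> (norm \<mu> + 1 / c) + - (Q z / 4)" using Q[of z] by simp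
      thus ?thesis unfolding exp_add[symmetric] by simp
    qed
    ultimately have "sqrt (\<kappa> ^ CARD('n)) * (exp (norm z) * exp (- (\<kappa> * Q z / 2))) \<le>
        \<kappa> ^ CARD('n) * (exp (norm \<mu> + 1 / c) * exp (- (Q z / 4)))"
      by (rule mult_mono) (use that in auto)
    hence "sqrt (\<kappa> ^ CARD('n)) * (exp (norm z) * exp (- (\<kappa> * Q z / 2))) / N \<le>
        \<kappa> ^ CARD('n) * (exp (norm \<mu> + 1 / c) * exp (- (Q z / 4))) / N"
      using N by (intro divide_right_mono) auto
    thus ?thesis
      using that dens[of \<kappa> z] dens[of "1 / 2" z] by (simp add: M0_def mult_ac)
  qed
  have "(\<integral>\<^sup>+z. ennreal (exp (norm z)) \<partial>mvn \<mu> ((1 / \<kappa>) *\<^sub>R \<Sigma>)) \<le> ennreal (\<kappa> ^ CARD('n) * max 3 M0)" if "\<kappa> \<ge> 1" for \<kappa>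
  proof -
    have pd: "pos_def ((1 / \<kappa>) *\<^sub>R \<Sigma>)" "pos_def ((1 / (1 / 2)) *\<^sub>R \<Sigma>)"
      using that by (auto intro!: pos_def_scaleR \<Sigma>)
    have "(\<integral>\<^sup>+z. ennreal (exp (norm z)) \<partial>mvn \<mu> ((1 / \<kappa>) *\<^sub>R \<Sigma>)) =
        (\<integral>\<^sup>+z. ennreal (exp (norm z) * mvn_density \<mu> ((1 / \<kappa>) *\<^sub>R \<Sigma>) z) \<partial>lborel)"
      unfolding mvn_def using mvn_density_pos[OF pd(1)]
      by (subst nn_integral_density) (auto simp: ennreal_mult[symmetric] less_imp_le mult.commute)
    also have "\<dots> \<le> (\<integral>\<^sup>+z. ennreal (\<kappa> ^ CARD('n) * M0) * ennreal (mvn_density \<mu> ((1 / (1 / 2)) *\<^sub>R \<Sigma>) z) \<partial>lborel)"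
      using bd[OF that] M0 that mvn_density_pos[OF pd(2)]
      by (intro nn_integral_mono) (auto simp: ennreal_mult[symmetric] less_imp_le intro!: ennreal_leI)
    also have "\<dots> = ennreal (\<kappa> ^ CARD('n) * M0)"
      by (subst nn_integral_cmult) (simp_all only: nn_integral_mvn_density[OF pd(2)] mult_1_right, measurable)
    also have "\<dots> \<le> ennreal (\<kappa> ^ CARD('n) * max 3 M0)"
      using that by (intro ennreal_leI mult_left_mono) auto
    finally show ?thesis .
  qed
  thus ?thesis by (intro exI[of _ "max 3 M0"]) auto
qed

text \<open>Points of these balls have norm at most 2, so the form is bounded there uniformly in
  \<open>j\<close> and the density is at least exp (-a \<kappa>) / N. All the balls have the same
  volume \<open>V\<close>.\<close>

lemma mvn_coordinate_ball_lower:
  fixes \<mu> :: "real ^ 'n"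
  assumes \<Sigma>: "pos_def \<Sigma>"
  shows "\<exists>L>0. \<exists>a>0. \<forall>\<kappa>\<ge>1. \<forall>j. L * exp (- (a * \<kappa>)) \<le>
    measure (mvn \<mu> ((1 / \<kappa>) *\<^sub>R \<Sigma>)) (ball (axis j 1) (1 / (2 * real CARD('n))))"
proof -
  define Q where "Q z = (z - \<mu>) \<bullet> (matrix_inv \<Sigma> *v (z - \<mu>))" for z
  define N where "N = sqrt ((2 * pi) ^ CARD('n) * det \<Sigma>)"
  have N: "N > 0" using pos_def_det[OF \<Sigma>] by (simp add: N_def)
  define \<rho> where "\<rho> = 1 / (2 * real CARD('n))"
  have "1 \<le> real CARD('n)" by simp
  hence \<rho>: "0 < \<rho>" "\<rho> \<le> 1" unfolding \<rho>_def by (simp, subst divide_le_eq_1) linarith+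
  define V where "V = measure lborel (ball (0 :: real ^ 'n) \<rho>)"
  have V: "V > 0" using \<rho> by (simp add: V_def)
  define K where "K = onorm ((*v) (matrix_inv \<Sigma>))"
  have K: "K \<ge> 0" unfolding K_def by (intro onorm_pos_le matrix_vector_mul_bounded_linear)
  define a where "a = K * (2 + norm \<mu>)\<^sup>2 / 2 + 1"
  have a: "a > 0" unfolding a_def using K by (intro add_nonneg_pos) auto
  have bound: "V / N * exp (- (a * \<kappa>)) \<le> measure (mvn \<mu> ((1 / \<kappa>) *\<^sub>R \<Sigma>)) (ball (axis j 1) \<rho>)"
    if \<kappa>: "\<kappa> \<ge> 1" for \<kappa> j
  proof -
    let ?B = "ball (axis j 1 :: real ^ 'n) \<rho>" and ?N = "mvn \<mu> ((1 / \<kappa>) *\<^sub>R \<Sigma>)"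
    have low: "1 / N * exp (- (a * \<kappa>)) \<le> mvn_density \<mu> ((1 / \<kappa>) *\<^sub>R \<Sigma>) z" if "z \<in> ?B" for z
    proof -
      have "norm z \<le> norm (axis j 1 :: real ^ 'n) + dist (axis j 1) z"
        by (metis dist_commute dist_norm norm_triangle_sub)
      hence "norm z \<le> 2" using that \<rho> by simp
      hence nz: "norm (z - \<mu>) \<le> 2 + norm \<mu>" using norm_triangle_ineq4[of z \<mu>] by simp
      have "Q z \<le> norm (z - \<mu>) * norm (matrix_inv \<Sigma> *v (z - \<mu>))" unfolding Q_def by (rule norm_cauchy_schwarz)
      also have "\<dots> \<le> norm (z - \<mu>) * (K * norm (z - \<mu>))"
        unfolding K_def by (intro mult_left_mono onorm matrix_vector_mul_bounded_linear) auto
      also have "\<dots> = K * (norm (z - \<mu>))\<^sup>2" by (simp add: power2_eq_square)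
      also have "\<dots> \<le> K * (2 + norm \<mu>)\<^sup>2" using K nz by (intro mult_left_mono power_mono) auto
      finally have "Q z / 2 \<le> a" by (simp add: a_def)
      hence "\<kappa> * (Q z / 2) \<le> \<kappa> * a" using \<kappa> by (intro mult_left_mono) auto
      hence "exp (- (a * \<kappa>)) \<le> exp (- (\<kappa> * Q z / 2))" by (simp add: mult.commute)
      moreover have "1 \<le> sqrt (\<kappa> ^ CARD('n))" using one_le_power[OF \<kappa>] by simp
      ultimately have "1 / N * exp (- (a * \<kappa>)) \<le> sqrt (\<kappa> ^ CARD('n)) / N * exp (- (\<kappa> * Q z / 2))"
        using N by (intro mult_mono divide_right_mono) auto
      thus ?thesis using mvn_density_scaled[OF \<Sigma>, of \<kappa> \<mu> z] \<kappa> unfolding Q_def N_def by simp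
    qed
    have pd: "pos_def ((1 / \<kappa>) *\<^sub>R \<Sigma>)" using \<kappa> by (auto intro!: pos_def_scaleR \<Sigma>)
    interpret prob_space ?N by (rule prob_space_mvn[OF pd])
    have em: "emeasure lborel ?B = ennreal (measure lborel ?B)"
      using emeasure_lborel_ball_finite[of "axis j 1 :: real ^ 'n" \<rho>]
      by (intro emeasure_eq_ennreal_measure) (simp add: less_top[symmetric])
    have "ennreal (V / N * exp (- (a * \<kappa>))) = ennreal (1 / N * exp (- (a * \<kappa>))) * ennreal (measure lborel ?B)"
      using N V \<rho> by (simp add: V_def content_ball ennreal_mult[symmetric] mult_ac)
    also have "\<dots> = (\<integral>\<^sup>+z. ennreal (1 / N * exp (- (a * \<kappa>))) * indicator ?B z \<partial>lborel)"
      unfolding em[symmetric] by (rule nn_integral_cmult_indicator[symmetric]) simp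
    also have "\<dots> \<le> (\<integral>\<^sup>+z. ennreal (mvn_density \<mu> ((1 / \<kappa>) *\<^sub>R \<Sigma>) z) * indicator ?B z \<partial>lborel)"
      using low by (intro nn_integral_mono) (auto simp: indicator_def intro!: ennreal_leI)
    also have "\<dots> = emeasure ?N ?B" unfolding mvn_def by (subst emeasure_density) auto
    also have "\<dots> = ennreal (measure ?N ?B)" by (rule emeasure_eq_measure)
    finally show ?thesis by (simp add: ennreal_le_iff)
  qed
  show ?thesis
    using bound V N a unfolding \<rho>_def by (intro exI[of _ "V / N"] exI[of _ a] conjI allI impI) auto
qed

text \<open>With \<open>p\<close> the density, \<open>p z = p (-z) * exp (v \<bullet> z)\<close> for the stated \<open>v\<close>, so the integrand
  \<open>p z * z j / (1 + exp (v \<bullet> z)) = z j * p z * p (-z) / (p z + p (-z))\<close> is odd.\<close>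

lemma mvn_gradient_mean_zero:
  fixes \<mu> :: "real ^ 'n"
  assumes \<Sigma>: "pos_def \<Sigma>" and \<kappa>: "\<kappa> > 0"
  defines "v \<equiv> (2 * \<kappa>) *\<^sub>R (matrix_inv \<Sigma> *v \<mu>)"
  shows "(\<integral>z. z $ j / (1 + exp (v \<bullet> z)) \<partial>mvn \<mu> ((1 / \<kappa>) *\<^sub>R \<Sigma>)) = 0"
proof -
  define p where "p = mvn_density \<mu> ((1 / \<kappa>) *\<^sub>R \<Sigma>)"
  have [measurable]: "p \<in> borel_measurable borel" by (simp add: p_def)
  have pd: "pos_def ((1 / \<kappa>) *\<^sub>R \<Sigma>)" using \<kappa> by (auto intro!: pos_def_scaleR \<Sigma>)
  have sym: "x \<bullet> (matrix_inv \<Sigma> *v y) = y \<bullet> (matrix_inv \<Sigma> *v x)" for x y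
    using pos_def_matrix_inv[OF \<Sigma>] by (metis dot_lmul_matrix inner_commute pos_def_def transpose_matrix_vector)
  \<comment> \<open>The forms at z - \<mu> and -z - \<mu> differ by four times the cross term;
    multiplied by \<kappa> / 2 this yields the factor 2 \<kappa> in \<open>v\<close>.\<close>
  have ratio: "p z = p (- z) * exp (v \<bullet> z)" for z
  proof -
    let ?B = "matrix_inv \<Sigma>"
    have "- z - \<mu> = - (z + \<mu>)" by simp
    hence "(- z - \<mu>) \<bullet> (?B *v (- z - \<mu>)) = (z + \<mu>) \<bullet> (?B *v (z + \<mu>))"
      by (simp only: linear_neg[OF matrix_vector_mul_linear] inner_minus_left inner_minus_right minus_minus)
    hence "(z - \<mu>) \<bullet> (?B *v (z - \<mu>)) = (- z - \<mu>) \<bullet> (?B *v (- z - \<mu>)) - 4 * (z \<bullet> (?B *v \<mu>))"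
      using sym[of \<mu> z] by (simp add: linear_diff[OF matrix_vector_mul_linear] linear_add[OF matrix_vector_mul_linear]
          inner_diff_left inner_diff_right inner_add_left inner_add_right)
    hence "- (\<kappa> * ((z - \<mu>) \<bullet> (matrix_inv \<Sigma> *v (z - \<mu>))) / 2) =
      - (\<kappa> * ((- z - \<mu>) \<bullet> (matrix_inv \<Sigma> *v (- z - \<mu>))) / 2) + v \<bullet> z"
      by (simp only:) (simp add: v_def inner_commute field_simps)
    thus ?thesis
      unfolding p_def mvn_density_scaled[OF \<Sigma> \<kappa>] by (simp only: exp_add mult.assoc)
  qed
  define F where "F z = p z * (z $ j / (1 + exp (v \<bullet> z)))" for z
  have odd: "F (- z) = - F z" for z
  proof -
    have "1 + exp (v \<bullet> z) > 0" "exp (v \<bullet> z) > 0" by (auto simp: add_pos_pos)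
    hence "exp (v \<bullet> z) / (1 + exp (v \<bullet> z)) = 1 / (1 + exp (- (v \<bullet> z)))"
      by (simp add: exp_minus field_simps)
    hence "F (- z) = - (p (- z) * z $ j * (exp (v \<bullet> z) / (1 + exp (v \<bullet> z))))"
      by (simp add: F_def)
    also have "\<dots> = - (p (- z) * exp (v \<bullet> z) * (z $ j / (1 + exp (v \<bullet> z))))" by simp
    also have "\<dots> = - F z" by (simp only: ratio[symmetric] F_def)
    finally show ?thesis .
  qed
  have [measurable]: "F \<in> borel_measurable borel" unfolding F_def[abs_def] by measurable
  \<comment> \<open>Reflection shows that the integral equals its own negative. These rewrites also
    hold for a nonintegrable \<open>F\<close>, where the Bochner integral is 0.\<close>
  have "(\<integral>z. F z \<partial>lborel) = (\<integral>z. F z \<partial>distr lborel borel uminus)" by (simp add: distr_lborel_uminus)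
  also have "\<dots> = (\<integral>z. F (- z) \<partial>lborel)" by (rule integral_distr) auto
  also have "\<dots> = - (\<integral>z. F z \<partial>lborel)" by (simp add: odd)
  finally have "(\<integral>z. F z \<partial>lborel) = 0" by simp
  moreover have "(\<integral>z. z $ j / (1 + exp (v \<bullet> z)) \<partial>mvn \<mu> ((1 / \<kappa>) *\<^sub>R \<Sigma>)) = (\<integral>z. F z \<partial>lborel)"
    unfolding mvn_def F_def p_def using mvn_density_pos[OF pd]
    by (subst integral_density) (auto simp: less_imp_le)
  ultimately show ?thesis by simp
qed

section \<open>The sampling argument\<close>

lemma (in prob_space) iid_sums_small:
  fixes X :: "'j \<Rightarrow> 'a \<Rightarrow> real" and I :: "'i set"
  assumes I: "finite I" and J: "finite J" and X [measurable]: "\<And>j. j \<in> J \<Longrightarrow> X j \<in> borel_measurable M"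
    and EX: "\<And>j. j \<in> J \<Longrightarrow> expectation (X j) = 0"
    and B: "\<And>j. j \<in> J \<Longrightarrow> (\<integral>\<^sup>+x. ennreal (exp \<bar>X j x\<bar>) \<partial>M) \<le> ennreal B"
    and a: "0 < a" "a \<le> 4 * B"
  shows "measure (\<Pi>\<^sub>M i\<in>I. M) {S \<in> space (\<Pi>\<^sub>M i\<in>I. M). \<exists>j\<in>J. real (card I) * a \<le> (\<Sum>i\<in>I. X j (S i))}
    \<le> real (card J) * exp (- (real (card I) * a\<^sup>2 / (16 * B)))"
proof -
  let ?P = "\<Pi>\<^sub>M i\<in>I. M"
  note ch = chernoff_iid_sum[OF I X EX B a]
  interpret P: prob_space ?P by (rule prob_space_PiM) (rule prob_space_axioms)
  let ?E = "\<lambda>j. {S \<in> space ?P. real (card I) * a \<le> (\<Sum>i\<in>I. X j (S i))}"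
  have E: "?E j \<in> sets ?P" if "j \<in> J" for j
  proof -
    have [measurable]: "(\<lambda>S. X j (S i)) \<in> borel_measurable ?P" if "i \<in> I" for i
      using measurable_compose[OF measurable_component_singleton[OF that] X[OF \<open>j \<in> J\<close>]] .
    show ?thesis by measurable
  qed
  have "measure ?P (\<Union>j\<in>J. ?E j) \<le> (\<Sum>j\<in>J. measure ?P (?E j))"
    using E by (intro P.finite_measure_subadditive_finite J) auto
  also have "\<dots> \<le> (\<Sum>j\<in>J. exp (- (real (card I) * a\<^sup>2 / (16 * B))))"
    by (intro sum_mono ch)
  also have "(\<Union>j\<in>J. ?E j) = {S \<in> space ?P. \<exists>j\<in>J. real (card I) * a \<le> (\<Sum>i\<in>I. X j (S i))}" by auto
  finally show ?thesis by simp
qed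

text \<open>The factor 3 d counts the bad events: for each coordinate, two signs of the gradient and
  one count of samples near the unit vector, all with threshold \<open>t\<close>. Since t \<le> q, a
  ball of mass at least 2 q still receives a fraction q of the sample.\<close>

lemma erm_direction_probability:
  fixes \<mu> :: "real ^ 'n" and \<Sigma> :: "real ^ 'n ^ 'n"
  defines "d \<equiv> real CARD('n)"
  assumes \<mu>: "\<mu> \<noteq> 0" and \<Sigma>: "pos_def \<Sigma>" and \<kappa>: "\<kappa> \<ge> 1" and \<epsilon>: "0 < \<epsilon>" "\<epsilon> < 1" and n: "n > 0"
  defines "v \<equiv> (2 * \<kappa>) *\<^sub>R (matrix_inv \<Sigma> *v \<mu>)"
  assumes B: "B \<ge> 3" "(\<integral>\<^sup>+z. ennreal (exp (norm z)) \<partial>mvn \<mu> ((1 / \<kappa>) *\<^sub>R \<Sigma>)) \<le> ennreal B"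
    and q: "0 < q" "\<And>j. 2 * q \<le> measure (mvn \<mu> ((1 / \<kappa>) *\<^sub>R \<Sigma>)) (ball (axis j 1) (1 / (2 * d)))"
    and t: "0 < t" "t \<le> 1" "t \<le> q" "t < exp (- (4 * norm v)) / 8 * q * (\<epsilon> / 2 * norm v) / (4 * d ^ 3)"
  shows "measure (sample_dist \<mu> \<Sigma> \<kappa> n)
      {S \<in> space (sample_dist \<mu> \<Sigma> \<kappa> n).
         \<exists>w. unique_minimizer (erm_loss n S) w \<and> w \<noteq> 0 \<and> cos_sim w (matrix_inv \<Sigma> *v \<mu>) \<ge> 1 - \<epsilon>}
    \<ge> 1 - 3 * d * exp (- (real n * t\<^sup>2 / (16 * B)))"
proof -
  define D where "D = data_dist \<mu> \<Sigma> \<kappa>"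
  define N where "N = mvn \<mu> ((1 / \<kappa>) *\<^sub>R \<Sigma>)"
  define P where "P = sample_dist \<mu> \<Sigma> \<kappa> n"
  define u where "u = matrix_inv \<Sigma> *v \<mu>"
  have \<kappa>0: "\<kappa> > 0" using \<kappa> by simp
  have P: "P = (\<Pi>\<^sub>M i\<in>{1..n}. D)" by (simp add: P_def D_def sample_dist_def)
  have u0: "u \<noteq> 0"
  proof
    assume "u = 0"
    hence "\<Sigma> *v u = 0" by simp
    thus False using \<mu> invertible_matrix_inv[OF pos_def_invertible[OF \<Sigma>]] by (simp add: u_def matrix_vector_mul_assoc)
  qed
  have v: "v = (2 * \<kappa>) *\<^sub>R u" by (simp add: v_def u_def)
  have v0: "v \<noteq> 0" using u0 \<kappa> by (simp add: v)
  have pd: "pos_def ((1 / \<kappa>) *\<^sub>R \<Sigma>)" by (rule pos_def_cov[OF \<Sigma> \<kappa>0])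
  have setsD [measurable_cong]: "sets D = sets (borel \<Otimes>\<^sub>M count_space UNIV)"
    unfolding D_def by (rule sets_data_dist[OF \<Sigma> \<kappa>0])
  interpret D: prob_space D unfolding D_def by (rule prob_space_data_dist[OF \<Sigma> \<kappa>0])
  interpret N: prob_space N unfolding N_def by (rule prob_space_mvn[OF pd])
  interpret P: prob_space P unfolding P by (rule prob_space_PiM) (rule D.prob_space_axioms)
  have setsN [simp, measurable_cong]: "sets N = sets borel" by (simp add: N_def)
  have [simp]: "space N = UNIV" by (simp add: N_def)
  have N_eq: "N = distr D borel signed_feature"
    unfolding N_def D_def by (rule distr_signed_feature[OF \<Sigma> \<kappa>0, symmetric])
  have sf [measurable]: "signed_feature \<in> D \<rightarrow>\<^sub>M borel" by measurable

  define Ball where "Ball j = ball (axis j 1 :: real ^ 'n) (1 / (2 * d))" for j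
  define g where "g j z = z $ j / (1 + exp (v \<bullet> z))" for j :: 'n and z :: "real ^ 'n"
  \<comment> \<open>One family for all statistics of the one-sided Chernoff bound: k = 1 and k = -1
    give both tails of a gradient coordinate, while k = 0 is centred so that a large sum means too
    few samples in the ball.\<close>
  define X where "X = (\<lambda>(j, k) z. if k = 0 then measure N (Ball j) - indicator (Ball j) z else k * g j z)"
  define J where "J = (UNIV :: 'n set) \<times> {-1, 0, 1 :: real}"
  have g_meas [measurable]: "g j \<in> borel_measurable borel" for j unfolding g_def[abs_def] by measurable
  have X_meas [measurable]: "X jk \<in> borel_measurable borel" for jk
  proof (cases jk)
    case (Pair j k)
    have [measurable]: "Ball j \<in> sets borel" by (simp add: Ball_def)
    have "(\<lambda>z. measure N (Ball j) - indicator (Ball j) z) \<in> borel_measurable borel" by measurable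
    moreover have "(\<lambda>z. k * g j z) \<in> borel_measurable borel" by measurable
    ultimately show ?thesis by (cases "k = 0") (simp_all add: X_def Pair)
  qed
  have X_mean: "(\<integral>z. X jk z \<partial>N) = 0" for jk
  proof (cases jk)
    case (Pair j k)
    have [measurable]: "Ball j \<in> sets N" by (simp add: Ball_def)
    have "(\<integral>z. g j z \<partial>N) = 0"
      unfolding g_def N_def v_def by (rule mvn_gradient_mean_zero[OF \<Sigma> \<kappa>0])
    moreover have "(\<integral>z. measure N (Ball j) - indicator (Ball j) z \<partial>N) = 0"
    proof (subst Bochner_Integration.integral_diff)
      show "integrable N (indicator (Ball j) :: _ \<Rightarrow> real)"
        by (intro integrable_real_indicator) (simp_all add: N.emeasure_eq_measure Ball_def)
    qed (use N.prob_space in simp_all)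
    ultimately show ?thesis by (cases "k = 0") (simp_all add: X_def Pair)
  qed
  have X_exp: "(\<integral>\<^sup>+z. ennreal (exp \<bar>X jk z\<bar>) \<partial>N) \<le> ennreal B" if "jk \<in> J" for jk
  proof (cases jk)
    case (Pair j k)
    show ?thesis
    proof (cases "k = 0")
      case True
      have "\<bar>X jk z\<bar> \<le> 1" for z
      proof -
        have "\<bar>p - indicator (Ball j) z\<bar> \<le> 1" if "0 \<le> p" "p \<le> 1" for p :: real
          using that by (auto simp: indicator_def)
        thus ?thesis using True by (simp add: X_def Pair)
      qed
      hence "exp \<bar>X jk z\<bar> \<le> B" for z
        \<comment> \<open>The premise \<open>B \<ge> 3\<close> enters here: exp 1 is at most
          3.\<close>
        using exp_le B(1) by (metis exp_le_cancel_iff order_trans)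
      hence "(\<integral>\<^sup>+z. ennreal (exp \<bar>X jk z\<bar>) \<partial>N) \<le> (\<integral>\<^sup>+z. ennreal B \<partial>N)"
        by (intro nn_integral_mono ennreal_leI)
      thus ?thesis using N.emeasure_space_1 by simp
    next
      case False
      have "\<bar>X jk z\<bar> \<le> norm z" for z
      proof -
        have "\<bar>X jk z\<bar> = \<bar>z $ j\<bar> / (1 + exp (v \<bullet> z))"
          using that False by (auto simp: X_def Pair J_def g_def abs_mult abs_divide add_pos_pos abs_of_pos)
        also have "\<dots> \<le> \<bar>z $ j\<bar> / 1" by (intro divide_left_mono) (auto simp: add_pos_pos)
        also have "\<dots> \<le> norm z" using component_le_norm_cart[of z j] by simp
        finally show ?thesis .
      qed
      hence "(\<integral>\<^sup>+z. ennreal (exp \<bar>X jk z\<bar>) \<partial>N) \<le> (\<integral>\<^sup>+z. ennreal (exp (norm z)) \<partial>N)"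
        by (intro nn_integral_mono ennreal_leI) simp
      thus ?thesis using B(2) unfolding N_def by simp
    qed
  qed
  define Bad where "Bad = {S \<in> space P. \<exists>jk\<in>J. real n * t \<le> (\<Sum>i=1..n. X jk (signed_feature (S i)))}"
  have "finite J" "card J = CARD('n) * 3" by (simp_all add: J_def card_cartesian_product)
  have prob_Bad: "measure P Bad \<le> 3 * d * exp (- (real n * t\<^sup>2 / (16 * B)))"
  proof -
    have "measure (\<Pi>\<^sub>M i\<in>{1..n}. D) {S \<in> space (\<Pi>\<^sub>M i\<in>{1..n}. D). \<exists>jk\<in>J. real (card {1..n}) * t \<le> (\<Sum>i\<in>{1..n}. X jk (signed_feature (S i)))}
      \<le> real (card J) * exp (- (real (card {1..n}) * t\<^sup>2 / (16 * B)))"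
    proof (rule D.iid_sums_small)
      fix jk assume jk: "jk \<in> J"
      show "(\<lambda>p. X jk (signed_feature p)) \<in> borel_measurable D"
        by (rule measurable_compose[OF sf X_meas])
      show "D.expectation (\<lambda>p. X jk (signed_feature p)) = 0"
        using X_mean[of jk] unfolding N_eq by (subst (asm) integral_distr[OF sf X_meas])
      have "(\<lambda>z. ennreal (exp \<bar>X jk z\<bar>)) \<in> borel_measurable borel" by measurable
      thus "(\<integral>\<^sup>+p. ennreal (exp \<bar>X jk (signed_feature p)\<bar>) \<partial>D) \<le> ennreal B"
        using X_exp[OF jk] unfolding N_eq by (subst (asm) nn_integral_distr[OF sf]) simp_all
    qed (use \<open>finite J\<close> t B in auto)
    thus ?thesis by (simp add: Bad_def P \<open>card J = _\<close> d_def mult_ac)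
  qed

  \<comment> \<open>The cosine condition with its denominator cleared, which makes the set closed.
    It then contains 0, so \<open>w \<noteq> 0\<close> stays a separate condition.\<close>
  define K where "K = {w. (1 - \<epsilon>) * (norm w * norm u) \<le> w \<bullet> u}"
  have K: "closed K" "K \<noteq> {}"
  proof -
    show "closed K" unfolding K_def by (intro closed_Collect_le continuous_intros)
    have "0 \<in> K" by (simp add: K_def)
    thus "K \<noteq> {}" by blast
  qed
  have inK: "w \<in> K \<longleftrightarrow> cos_sim w u \<ge> 1 - \<epsilon>" if "w \<noteq> 0" for w
    using that u0 by (simp add: K_def cos_sim_def pos_le_divide_eq)
  define E where "E = {S \<in> space P. \<exists>w. unique_minimizer (erm_loss n S) w \<and> w \<noteq> 0 \<and> cos_sim w u \<ge> 1 - \<epsilon>}"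
  have E_eq: "E = {S \<in> space P. \<exists>w. unique_minimizer (erm_loss n S) w \<and> w \<noteq> 0 \<and> w \<in> K}"
    unfolding E_def using inK by blast
  have E_sets [measurable]: "E \<in> sets P"
    unfolding E_eq
  proof (rule sets_unique_minimizer_in_closed[OF convex_on_erm_loss K])
    fix w :: "real ^ 'n"
    have [measurable]: "logistic_loss \<in> borel_measurable borel"
      unfolding logistic_loss_def[abs_def] by measurable
    have h: "(\<lambda>p. logistic_loss (w \<bullet> fst p) + (1 - real (snd p)) * (w \<bullet> fst p)) \<in> borel_measurable D"
      by measurable
    have [measurable]: "(\<lambda>S. logistic_loss (w \<bullet> fst (S i)) + (1 - real (snd (S i))) * (w \<bullet> fst (S i))) \<in> borel_measurable P"
      if "i \<in> {1..n}" for i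
      unfolding P by (rule measurable_compose[OF measurable_component_singleton[OF that] h])
    show "(\<lambda>S. erm_loss n S w) \<in> borel_measurable P"
      unfolding erm_loss_eq_tilted by measurable
  qed
  have good: "S \<in> E" if S: "S \<in> space P" "S \<notin> Bad" and lab: "\<And>i. i \<in> {1..n} \<Longrightarrow> snd (S i) = 0 \<or> snd (S i) = 1" for S
  proof -
    have small: "(\<Sum>i=1..n. X jk (signed_feature (S i))) \<le> real n * t" if "jk \<in> J" for jk
      using S that unfolding Bad_def by (auto simp: not_le intro: less_imp_le)
    have "\<exists>w. unique_minimizer (erm_loss n S) w \<and> dist w v \<le> \<epsilon> / 2 * norm v"
    proof (rule erm_minimizer_near[OF n lab])
      show "0 < \<epsilon> / 2 * norm v" using \<epsilon> v0 by simp
      show "\<epsilon> / 2 * norm v \<le> norm v" using \<epsilon> by (intro mult_left_le_one_le) auto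
      show "0 < q" by (rule q(1))
      show "t < exp (- (4 * norm v)) / 8 * q * (\<epsilon> / 2 * norm v) / (4 * real CARD('n) ^ 3)"
        using t(4) unfolding d_def .
    next
      fix j :: 'n
      have "(\<Sum>i=1..n. g j (signed_feature (S i))) \<le> real n * t"
        using small[of "(j, 1)"] by (simp add: J_def X_def)
      moreover have "- (\<Sum>i=1..n. g j (signed_feature (S i))) \<le> real n * t"
        using small[of "(j, -1)"] by (simp add: J_def X_def sum_negf)
      ultimately show "\<bar>\<Sum>i=1..n. signed_feature (S i) $ j / (1 + exp (v \<bullet> signed_feature (S i)))\<bar> \<le> real n * t"
        unfolding g_def by (simp add: abs_le_iff)
      have "(\<Sum>i=1..n. indicator (Ball j) (signed_feature (S i))) =
          real (card {i \<in> {1..n}. signed_feature (S i) \<in> Ball j})"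
        by (simp add: indicator_def sum.If_cases Int_def)
      moreover have "(\<Sum>i=1..n. measure N (Ball j) - indicator (Ball j) (signed_feature (S i))) \<le> real n * t"
        using small[of "(j, 0)"] by (simp add: J_def X_def)
      ultimately have "real n * measure N (Ball j) - real n * t \<le> real (card {i \<in> {1..n}. signed_feature (S i) \<in> Ball j})"
        by (simp add: sum_subtractf)
      moreover have "real n * (q + t) \<le> real n * measure N (Ball j)"
        using q(2)[of j] t(3) by (intro mult_left_mono) (auto simp: N_def Ball_def)
      ultimately show "real n * q \<le> real (card {i \<in> {1..n}. signed_feature (S i) \<in> ball (axis j 1) (1 / (2 * real CARD('n)))})"
        unfolding Ball_def d_def by (simp add: distrib_left)
    qed
    then obtain w where w: "unique_minimizer (erm_loss n S) w" "dist w v \<le> \<epsilon> / 2 * norm v" by blast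
    have "cos_sim w u = cos_sim w v" using \<kappa>0 by (simp add: v cos_sim_scaleR_right)
    thus ?thesis
      using S(1) w(1) cos_sim_ge_of_dist[OF v0 \<epsilon> w(2)] unfolding E_def by auto
  qed
  have label: "AE p in D. snd p = 0 \<or> snd p = 1"
    unfolding D_def by (rule AE_data_dist_label[OF \<Sigma> \<kappa>0])
  have "AE S in P. \<forall>i\<in>{1..n}. snd (S i) = 0 \<or> snd (S i) = 1"
    unfolding P
    by (intro AE_finite_allI AE_PiM_component[where P="\<lambda>p. snd p = 0 \<or> snd p = 1"] D.prob_space_axioms label) auto
  hence "AE S in P. S \<in> space P - E \<longrightarrow> S \<in> Bad"
    by (rule eventually_mono) (use good in blast)
  moreover have "Bad \<in> sets P"
  proof -
    have [measurable]: "(\<lambda>S. X jk (signed_feature (S i))) \<in> borel_measurable P" if "i \<in> {1..n}" for i jk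
      unfolding P by (rule measurable_compose[OF measurable_component_singleton[OF that] measurable_compose[OF sf X_meas]])
    have "Bad = (\<Union>jk\<in>J. {S \<in> space P. real n * t \<le> (\<Sum>i=1..n. X jk (signed_feature (S i)))})"
      by (auto simp: Bad_def)
    also have "\<dots> \<in> sets P" by (intro sets.finite_UN \<open>finite J\<close>) measurable
    finally show ?thesis .
  qed
  ultimately have "measure P (space P - E) \<le> measure P Bad"
    by (intro P.finite_measure_mono_AE) auto
  hence "measure P E \<ge> 1 - 3 * d * exp (- (real n * t\<^sup>2 / (16 * B)))"
    using prob_Bad P.prob_compl[OF E_sets] by simp
  thus ?thesis unfolding E_def P_def u_def .
qed

theorem theorem3p4:
  fixes \<mu> :: "real ^ 'n" and \<Sigma> :: "real ^ 'n ^ 'n"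
  assumes "\<mu> \<noteq> 0"
    and "pos_def \<Sigma>"
    and "(norm \<mu>)\<^sup>2 = spectral_norm \<Sigma>"
  shows "\<exists>C>0. \<exists>\<kappa>\<^sub>0>0. \<forall>\<kappa>\<ge>\<kappa>\<^sub>0. \<forall>\<epsilon>\<in>{0<..<1}. \<forall>\<delta>\<in>{0<..<1}. \<forall>n::nat.
    real n \<ge> exp (C * \<kappa>\<^sup>2) / \<epsilon> ^ 4 * (1 + ln (1 / \<epsilon>) + ln (1 / \<delta>)) \<longrightarrow>
    measure (sample_dist \<mu> \<Sigma> \<kappa> n)
      {S \<in> space (sample_dist \<mu> \<Sigma> \<kappa> n).
         \<exists>w. unique_minimizer (erm_loss n S) w \<and> w \<noteq> 0 \<and>
             cos_sim w (matrix_inv \<Sigma> *v \<mu>) \<ge> 1 - \<epsilon>} \<ge> 1 - \<delta>"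
proof -
  define d where "d = real CARD('n)"
  have d: "d \<ge> 1" by (simp add: d_def)
  obtain M where M: "M \<ge> 3" "\<And>\<kappa>. \<kappa> \<ge> 1 \<Longrightarrow>
      (\<integral>\<^sup>+z. ennreal (exp (norm z)) \<partial>mvn \<mu> ((1 / \<kappa>) *\<^sub>R \<Sigma>)) \<le> ennreal (\<kappa> ^ CARD('n) * M)"
    using mvn_exp_norm_moment[OF assms(2), of \<mu>] by blast
  obtain L a where L: "L > 0" and a: "a > 0" and La: "\<And>\<kappa> j. \<kappa> \<ge> 1 \<Longrightarrow>
      L * exp (- (a * \<kappa>)) \<le> measure (mvn \<mu> ((1 / \<kappa>) *\<^sub>R \<Sigma>)) (ball (axis j 1) (1 / (2 * d)))"
    using mvn_coordinate_ball_lower[OF assms(2), of \<mu>] unfolding d_def by blast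
  \<comment> \<open>Chosen so that |v| = \<kappa> \<omega>, which makes the curvature factor exp (-4
    \<omega> \<kappa>).\<close>
  define \<omega> where "\<omega> = 2 * norm (matrix_inv \<Sigma> *v \<mu>)"
  have \<omega>: "\<omega> > 0"
  proof -
    have "matrix_inv \<Sigma> *v \<mu> \<noteq> 0"
    proof
      assume "matrix_inv \<Sigma> *v \<mu> = 0"
      hence "\<Sigma> *v (matrix_inv \<Sigma> *v \<mu>) = 0" by simp
      thus False using assms(1) invertible_matrix_inv[OF pos_def_invertible[OF assms(2)]]
        by (simp add: matrix_vector_mul_assoc)
    qed
    thus ?thesis by (simp add: \<omega>_def)
  qed
  \<comment> \<open>The threshold will be t = \<open>c\<^sub>1\<close> \<epsilon> exp
    (-\<open>c\<^sub>2\<close> \<kappa>). The three entries serve t \<le> 1, t \<le> q and the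
    localisation bound, whose constant is L \<omega> / (128 d^3); 256 makes that bound strict.
    \<open>c\<^sub>2\<close> adds the rates of curvature and ball mass.\<close>
  define c\<^sub>1 where "c\<^sub>1 = Min {1, L / 2, L * \<omega> / (256 * d ^ 3)}"
  define c\<^sub>2 where "c\<^sub>2 = 4 * \<omega> + a"
  have c1: "c\<^sub>1 > 0" "c\<^sub>1 \<le> 1" "c\<^sub>1 \<le> L / 2" "c\<^sub>1 \<le> L * \<omega> / (256 * d ^ 3)"
    using L \<omega> d by (auto simp: c\<^sub>1_def)
  have c2: "c\<^sub>2 > 0" using \<omega> a by (simp add: c\<^sub>2_def)
  \<comment> \<open>Absorbs the union bound factor: ln (3 d) + ln (1/\<delta>) is at most H (1 + ln
    (1/\<delta>)).\<close>
  define H where "H = 1 + ln (3 * d)"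
  have H: "H \<ge> 1" using d by (simp add: H_def)
  define R where "R = 16 * M * H / c\<^sub>1\<^sup>2"
  have R: "R > 0" using M H c1 by (simp add: R_def)
  \<comment> \<open>One summand for each factor of the sample size: the constant \<open>R\<close>,
    the power \<kappa>^d from the moment bound, and 1 / t^2. Each is at most exp of its summand
    times \<kappa>^2 once \<kappa> \<ge> 1.\<close>
  define C where "C = R + d + 2 * c\<^sub>2"
  have C: "C > 0" using R d c2 by (simp add: C_def)
  have expC: "R * (\<kappa> ^ CARD('n) * exp (2 * c\<^sub>2 * \<kappa>)) \<le> exp (C * \<kappa>\<^sup>2)" if \<kappa>: "\<kappa> \<ge> 1" for \<kappa>
  proof -
    have k: "\<kappa> \<le> \<kappa>\<^sup>2" "1 \<le> \<kappa>\<^sup>2" using \<kappa> by (simp_all add: power2_eq_square mult_ge1_I)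
    have "R \<le> exp R" using exp_ge_add_one_self[of R] by linarith
    also have "\<dots> \<le> exp (R * \<kappa>\<^sup>2)" using R k(2) by simp
    finally have 1: "R \<le> exp (R * \<kappa>\<^sup>2)" .
    have "\<kappa> \<le> exp \<kappa>" using exp_ge_add_one_self[of \<kappa>] by linarith
    hence "\<kappa> ^ CARD('n) \<le> exp \<kappa> ^ CARD('n)" using \<kappa> by (intro power_mono) auto
    also have "\<dots> = exp (d * \<kappa>)" by (simp add: d_def exp_of_nat_mult)
    also have "\<dots> \<le> exp (d * \<kappa>\<^sup>2)" using d k(1) by simp
    finally have 2: "\<kappa> ^ CARD('n) \<le> exp (d * \<kappa>\<^sup>2)" .
    have 3: "exp (2 * c\<^sub>2 * \<kappa>) \<le> exp (2 * c\<^sub>2 * \<kappa>\<^sup>2)" using c2 k(1) by simp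
    have "R * (\<kappa> ^ CARD('n) * exp (2 * c\<^sub>2 * \<kappa>)) \<le> exp (R * \<kappa>\<^sup>2) * (exp (d * \<kappa>\<^sup>2) * exp (2 * c\<^sub>2 * \<kappa>\<^sup>2))"
      using 1 2 3 R \<kappa> by (intro mult_mono) auto
    also have "\<dots> = exp (C * \<kappa>\<^sup>2)" by (simp add: C_def exp_add[symmetric] algebra_simps)
    finally show ?thesis .
  qed
  have main: "measure (sample_dist \<mu> \<Sigma> \<kappa> n)
      {S \<in> space (sample_dist \<mu> \<Sigma> \<kappa> n).
         \<exists>w. unique_minimizer (erm_loss n S) w \<and> w \<noteq> 0 \<and>
             cos_sim w (matrix_inv \<Sigma> *v \<mu>) \<ge> 1 - \<epsilon>} \<ge> 1 - \<delta>"
    if \<kappa>: "\<kappa> \<ge> 1" and \<epsilon>: "0 < \<epsilon>" "\<epsilon> < 1" and \<delta>: "0 < \<delta>" "\<delta> < 1"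
      and n: "real n \<ge> exp (C * \<kappa>\<^sup>2) / \<epsilon> ^ 4 * (1 + ln (1 / \<epsilon>) + ln (1 / \<delta>))" for \<kappa> \<epsilon> \<delta> :: real and n :: nat
  proof -
    define v where "v = (2 * \<kappa>) *\<^sub>R (matrix_inv \<Sigma> *v \<mu>)"
    have nv: "norm v = \<kappa> * \<omega>" using \<kappa> by (simp add: v_def \<omega>_def)
    define q where "q = L / 2 * exp (- (a * \<kappa>))"
    define t where "t = c\<^sub>1 * \<epsilon> * exp (- (c\<^sub>2 * \<kappa>))"
    define B where "B = \<kappa> ^ CARD('n) * M"
    have ln0: "ln (1 / \<epsilon>) > 0" "ln (1 / \<delta>) > 0" using \<epsilon> \<delta> by simp_all
    have t0: "t > 0" using c1 \<epsilon> by (simp add: t_def)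
    have B3: "B \<ge> 3"
    proof -
      have "1 * 3 \<le> B" unfolding B_def using one_le_power[OF \<kappa>, of "CARD('n)"] M(1) by (intro mult_mono) auto
      thus ?thesis by simp
    qed
    have t1: "t \<le> 1"
    proof -
      have "c\<^sub>1 * \<epsilon> * exp (- (c\<^sub>2 * \<kappa>)) \<le> 1 * 1 * 1"
        using c1 \<epsilon> c2 \<kappa> by (intro mult_mono) auto
      thus ?thesis by (simp add: t_def)
    qed
    have tq: "t \<le> q"
    proof -
      have "a * \<kappa> \<le> c\<^sub>2 * \<kappa>" using \<omega> \<kappa> by (simp add: c\<^sub>2_def)
      hence "c\<^sub>1 * \<epsilon> * exp (- (c\<^sub>2 * \<kappa>)) \<le> L / 2 * 1 * exp (- (a * \<kappa>))"
        using c1 \<epsilon> L by (intro mult_mono) auto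
      thus ?thesis by (simp add: t_def q_def)
    qed
    have t_small: "t < exp (- (4 * norm v)) / 8 * q * (\<epsilon> / 2 * norm v) / (4 * d ^ 3)"
    proof -
      define e where "e = exp (- (c\<^sub>2 * \<kappa>))"
      have ee: "exp (- (4 * norm v)) * exp (- (a * \<kappa>)) = e"
        by (simp add: e_def nv c\<^sub>2_def exp_add[symmetric] algebra_simps)
      have e0: "e > 0" by (simp add: e_def)
      have "t \<le> L * \<omega> / (256 * d ^ 3) * (\<epsilon> * e)"
        using mult_right_mono[OF c1(4), of "\<epsilon> * e"] \<epsilon> e0 by (simp add: t_def e_def mult.assoc)
      also have "\<dots> < L * \<omega> / (128 * d ^ 3) * (\<epsilon> * e)"
        using L \<omega> d \<epsilon> e0 by (intro mult_strict_right_mono divide_strict_left_mono) auto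
      also have "\<dots> = L * \<omega> / (128 * d ^ 3) * (\<epsilon> * e) * 1" by simp
      also have "\<dots> \<le> L * \<omega> / (128 * d ^ 3) * (\<epsilon> * e) * \<kappa>"
        using L \<omega> d \<epsilon> e0 \<kappa> by (intro mult_left_mono) auto
      also have "\<dots> = exp (- (4 * norm v)) / 8 * q * (\<epsilon> / 2 * norm v) / (4 * d ^ 3)"
        unfolding ee[symmetric] q_def by (simp add: nv field_simps)
      finally show ?thesis .
    qed
    have npos: "real n > 0"
    proof -
      have "0 < exp (C * \<kappa>\<^sup>2) / \<epsilon> ^ 4 * (1 + ln (1 / \<epsilon>) + ln (1 / \<delta>))"
        using ln0 \<epsilon> by (intro mult_pos_pos divide_pos_pos add_pos_pos) auto
      thus ?thesis using n by linarith
    qed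
    have rate: "ln (3 * d) + ln (1 / \<delta>) \<le> real n * t\<^sup>2 / (16 * B)"
    proof -
      define \<Lambda> where "\<Lambda> = 1 + ln (1 / \<epsilon>) + ln (1 / \<delta>)"
      define E where "E = exp (2 * c\<^sub>2 * \<kappa>)"
      have E: "E > 0" by (simp add: E_def)
      have "(exp (- (c\<^sub>2 * \<kappa>)))\<^sup>2 = 1 / E"
        unfolding E_def exp_double[symmetric] by (simp add: exp_minus divide_inverse mult.assoc)
      hence t2: "t\<^sup>2 = c\<^sub>1\<^sup>2 * \<epsilon>\<^sup>2 / E"
        by (simp add: t_def power_mult_distrib)
      have k: "\<kappa> ^ CARD('n) > 0" using \<kappa> by simp
      have "ln (3 * d) + ln (1 / \<delta>) \<le> H * (1 + ln (1 / \<delta>))"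
        using d ln0 by (simp add: H_def algebra_simps)
      also have "\<dots> \<le> H * \<Lambda>" unfolding \<Lambda>_def using H ln0 by (intro mult_left_mono) auto
      also have "\<dots> = R * (\<kappa> ^ CARD('n) * E) * \<Lambda> * c\<^sub>1\<^sup>2 / (16 * B * E)"
        using M(1) c1(1) E k \<kappa> by (simp add: R_def B_def field_simps)
      also have "\<dots> \<le> exp (C * \<kappa>\<^sup>2) * \<Lambda> * c\<^sub>1\<^sup>2 / (16 * B * E)"
        using expC[OF \<kappa>] B3 E ln0 by (intro divide_right_mono mult_right_mono) (auto simp: E_def \<Lambda>_def)
      also have "\<dots> \<le> (exp (C * \<kappa>\<^sup>2) / \<epsilon> ^ 4 * \<Lambda>) * \<epsilon>\<^sup>2 * c\<^sub>1\<^sup>2 / (16 * B * E)"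
      proof -
        \<comment> \<open>The factor \<epsilon>^2 in t^2 uses up only \<epsilon>^-2 of the available
          \<epsilon>^-4.\<close>
        have "\<epsilon> ^ 4 \<le> \<epsilon>\<^sup>2" using \<epsilon> by (intro power_decreasing) auto
        hence "1 \<le> \<epsilon>\<^sup>2 / \<epsilon> ^ 4" using \<epsilon> by simp
        hence "exp (C * \<kappa>\<^sup>2) * \<Lambda> * 1 \<le> exp (C * \<kappa>\<^sup>2) * \<Lambda> * (\<epsilon>\<^sup>2 / \<epsilon> ^ 4)"
          using ln0 by (intro mult_left_mono) (auto simp: \<Lambda>_def)
        hence "exp (C * \<kappa>\<^sup>2) * \<Lambda> \<le> exp (C * \<kappa>\<^sup>2) / \<epsilon> ^ 4 * \<Lambda> * \<epsilon>\<^sup>2" by (simp add: mult_ac)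
        thus ?thesis using B3 E by (intro divide_right_mono mult_right_mono) auto
      qed
      also have "\<dots> \<le> real n * \<epsilon>\<^sup>2 * c\<^sub>1\<^sup>2 / (16 * B * E)"
        using n B3 E unfolding \<Lambda>_def by (intro divide_right_mono mult_right_mono) auto
      also have "\<dots> = real n * t\<^sup>2 / (16 * B)" by (simp add: t2 mult_ac)
      finally show ?thesis .
    qed
    have "3 * d * exp (- (real n * t\<^sup>2 / (16 * B))) \<le> 3 * d * exp (- (ln (3 * d) + ln (1 / \<delta>)))"
      using rate d by (intro mult_left_mono) auto
    also have "\<dots> = \<delta>"
      using d \<delta> by (simp add: exp_minus exp_add exp_diff ln_div field_simps)
    finally have "1 - \<delta> \<le> 1 - 3 * d * exp (- (real n * t\<^sup>2 / (16 * B)))" by simp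
    also have "\<dots> \<le> measure (sample_dist \<mu> \<Sigma> \<kappa> n)
      {S \<in> space (sample_dist \<mu> \<Sigma> \<kappa> n).
         \<exists>w. unique_minimizer (erm_loss n S) w \<and> w \<noteq> 0 \<and>
             cos_sim w (matrix_inv \<Sigma> *v \<mu>) \<ge> 1 - \<epsilon>}"
      unfolding d_def
    proof (rule erm_direction_probability[OF assms(1,2) \<kappa> \<epsilon> _ B3])
      show "0 < n" using npos by simp
      show "(\<integral>\<^sup>+z. ennreal (exp (norm z)) \<partial>mvn \<mu> ((1 / \<kappa>) *\<^sub>R \<Sigma>)) \<le> ennreal B"
        unfolding B_def by (rule M(2)[OF \<kappa>])
      show "0 < q" using L by (simp add: q_def)
      show "2 * q \<le> measure (mvn \<mu> ((1 / \<kappa>) *\<^sub>R \<Sigma>)) (ball (axis j 1) (1 / (2 * real CARD('n))))" for j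
        using La[OF \<kappa>, of j] by (simp add: q_def d_def)
    qed (use t0 t1 tq t_small in \<open>simp_all only: v_def d_def\<close>)
    finally show ?thesis .
  qed
  show ?thesis
    \<comment> \<open>The threshold for \<kappa> is 1, the range in which the moment and ball
      estimates were proved.\<close>
    using C main by (intro exI[of _ C] conjI exI[of _ "1 :: real"]) auto
qed

end
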